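(* Let $(\alpha_n)_{n\in\mathbb N}$, $(\beta_n)_{n\in\mathbb N}$ be real sequences in $[-1,1]$ with $\alpha_n^2+\beta_n^2=1$ for all $n\in\mathbb N$, $\alpha_0=1$, and $\beta_n\neq 0$ for all $n\ge 1$. Let $\psi$ be a faithful state on $M_2(\mathbb C)$ and let $T_\psi$ be the associated transition operator on $\mathcal B(\mathcal H)$, $\mathcal H=\ell^2(\mathbb N)$. Then: 1. $T_\psi$ is irreducible. 2. If $T_\psi$ admits an invariant normal state, then $T_\psi$ is weakly mixing.
   Context: $\mathbb N$ includes $0$. $\mathcal H=\ell^2(\mathbb N)$ has canonical orthonormal basis $(e_n)_{n\in\mathbb N}$; $\mathbf 1$ is the identity operator. Let $a,b\in\mathcal B(\mathcal H)$ be the diagonal operators $a e_n=\alpha_n e_n$, $b e_n=\beta_n e_n$, and let $s$ be the isometric shift $s e_n=e_{n+1}$. Writing operators on $\mathcal H\otimes\mathbb C^2$ as $2\times2$ matrices with entries in $\mathcal B(\mathcal H)$ (so $x\otimes y=(y_{i,j}x)_{i,j}$), define the unitary $$u=\begin{pmatrix} s^*as & i s^*b\\ i bs & a\end{pmatrix}.$$ For a state $\psi$ on $M_2=M_2(\mathbb C)$ let $P_\psi:\mathcal B(\mathcal H\otimes\mathbb C^2)\to\mathcal B(\mathcal H)$ be the linear extension of $P_\psi(x\otimes y)=\psi(y)x$. The transition operator associated with $\psi$ is the unital completely positive normal map $T_\psi(x)=P_\psi\bigl(u^*(x\otimes\mathbf 1)u\bigr)$, $x\in\mathcal B(\mathcal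 H)$. A state $\varphi$ is faithful if $\varphi(x^*x)=0$ implies $x=0$. A state on $\mathcal B(\mathcal H)$ is normal if it has the form $\mathrm{Tr}(\rho\,\cdot\,)$ with $\rho$ trace class; it is invariant for $T$ if $\varphi\circ T=\varphi$. For a unital completely positive normal map $T$ on $\mathcal B(\mathcal H)$: an orthogonal projection $p$ is subharmonic if $T(p)\ge p$; $T$ is irreducible if its only subharmonic projections are $0$ and $\mathbf 1$; $T$ is weakly mixing if the multiples of $\mathbf 1$ are the only eigenvectors of $T$ for eigenvalues $\mu\in\mathbb C$ with $|\mu|=1$ (i.e. $T(x)=\mu x$ with $|\mu|=1$ implies $x\in\mathbb C\mathbf 1$). *)

theory Defs
  imports "HOL-Analysis.Analysis"
begin

class complex_vector = ab_group_add +
  fixes scaleC :: "complex \<Rightarrow> 'a \<Rightarrow> 'a" (infixr "*\<^sub>C" 75)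
  assumes scaleC_add_right: "c *\<^sub>C (x + y) = c *\<^sub>C x + c *\<^sub>C y"
    and scaleC_add_left: "(c + d) *\<^sub>C x = c *\<^sub>C x + d *\<^sub>C x"
    and scaleC_scaleC: "c *\<^sub>C d *\<^sub>C x = (c * d) *\<^sub>C x"
    and scaleC_one: "1 *\<^sub>C x = x"

section \<open>The Hilbert space of square-summable sequences\<close>

typedef ell2 = "{f :: nat \<Rightarrow> complex. summable (\<lambda>n. (cmod (f n))\<^sup>2)}"
  morphisms coord Abs_ell2
  by (rule exI[of _ "\<lambda>_. 0"]) simp

setup_lifting type_definition_ell2

lemma ell2_eqI: "(\<And>n. coord x n = coord y n) \<Longrightarrow> x = y"
  by (simp add: coord_inject[symmetric] fun_eq_iff)

lemma summable_coord: "summable (\<lambda>n. (cmod (coord x n))\<^sup>2)"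
  using coord[of x] by simp

lemma cmod_add_sq: "(cmod (a + b))\<^sup>2 \<le> 2 * (cmod a)\<^sup>2 + 2 * (cmod b)\<^sup>2"
proof -
  have "(cmod (a + b))\<^sup>2 \<le> (cmod a + cmod b)\<^sup>2"
    by (intro power_mono norm_triangle_ineq) auto
  also have "\<dots> \<le> 2 * (cmod a)\<^sup>2 + 2 * (cmod b)\<^sup>2"
    using zero_le_power2[of "cmod a - cmod b"]
    by (simp add: power2_eq_square algebra_simps)
  finally show ?thesis .
qed

lemma summable_sq_add:
  assumes "summable (\<lambda>n. (cmod (f n))\<^sup>2)" "summable (\<lambda>n. (cmod (g n))\<^sup>2)"
  shows "summable (\<lambda>n. (cmod (f n + g n))\<^sup>2)"
  by (rule summable_comparison_test'[where N = 0, OF summable_add[OF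
        summable_mult[OF assms(1), of 2] summable_mult[OF assms(2), of 2]]])
     (simp add: cmod_add_sq)

instantiation ell2 :: complex_vector
begin

lift_definition zero_ell2 :: ell2 is "\<lambda>_. 0" by simp
lift_definition plus_ell2 :: "ell2 \<Rightarrow> ell2 \<Rightarrow> ell2" is "\<lambda>f g n. f n + g n"
  by (rule summable_sq_add)
lift_definition uminus_ell2 :: "ell2 \<Rightarrow> ell2" is "\<lambda>f n. - f n" by simp
lift_definition minus_ell2 :: "ell2 \<Rightarrow> ell2 \<Rightarrow> ell2" is "\<lambda>f g n. f n - g n"
  using summable_sq_add[of _ "\<lambda>n. - _ n"] by simp
lift_definition scaleC_ell2 :: "complex \<Rightarrow> ell2 \<Rightarrow> ell2" is "\<lambda>c f n. c * f n"
  by (simp add: norm_mult power_mult_distrib summable_mult)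

instance
  by standard (transfer; simp add: fun_eq_iff algebra_simps)+

end

lemma coord_simps [simp]:
  "coord 0 n = 0" "coord (x + y) n = coord x n + coord y n"
  "coord (- x) n = - coord x n" "coord (x - y) n = coord x n - coord y n"
  "coord (c *\<^sub>C x) n = c * coord x n"
  by (transfer; simp)+

definition cinner :: "ell2 \<Rightarrow> ell2 \<Rightarrow> complex" where
  "cinner x y = (\<Sum>n. cnj (coord x n) * coord y n)"

lemma summable_cinner: "summable (\<lambda>n. cnj (coord x n) * coord y n)"
proof (rule summable_comparison_test'[where N = 0, OF summable_add[OF
        summable_coord[of x] summable_coord[of y]]])
  fix n :: nat
  have "0 \<le> (cmod (coord x n) - cmod (coord y n))\<^sup>2 + (cmod (coord x n))\<^sup>2 + (cmod (coord y n))\<^sup>2"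
    by simp
  then show "norm (cnj (coord x n) * coord y n) \<le> (cmod (coord x n))\<^sup>2 + (cmod (coord y n))\<^sup>2"
    by (simp add: norm_mult power2_eq_square algebra_simps)
qed

lemma cinner_add_right: "cinner x (y + z) = cinner x y + cinner x z"
  by (simp add: cinner_def distrib_left suminf_add[OF summable_cinner summable_cinner])

lemma cinner_scale_right: "cinner x (c *\<^sub>C y) = c * cinner x y"
  unfolding cinner_def by (subst suminf_mult[OF summable_cinner, symmetric]) (simp add: mult_ac)

lemma cinner_commute: "cinner y x = cnj (cinner x y)"
proof -
  have "(\<lambda>n. cnj (cnj (coord x n) * coord y n)) sums cnj (cinner x y)"
    unfolding cinner_def by (subst sums_cnj) (rule summable_sums[OF summable_cinner])
  then show ?thesis
    by (simp add: cinner_def sums_iff mult.commute)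
qed

lemma cinner_add_left: "cinner (x + y) z = cinner x z + cinner y z"
  by (metis cinner_add_right cinner_commute complex_cnj_add)

lemma cinner_scale_left: "cinner (c *\<^sub>C x) y = cnj c * cinner x y"
  by (metis cinner_scale_right cinner_commute complex_cnj_mult)

lemma cinner_self: "cinner x x = of_real (\<Sum>n. (cmod (coord x n))\<^sup>2)"
  unfolding cinner_def
  by (subst suminf_of_real[OF summable_coord])
     (simp only: complex_norm_square mult.commute)

text \<open>The underlying real inner product space supplies the norm and topology.\<close>

instantiation ell2 :: real_vector
begin

definition scaleR_ell2 :: "real \<Rightarrow> ell2 \<Rightarrow> ell2" where "scaleR_ell2 r x = of_real r *\<^sub>C x"

instance
  by standard
    (simp_all add: scaleR_ell2_def scaleC_add_right scaleC_add_left scaleC_scaleC scaleC_one)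

end

instantiation ell2 :: real_inner
begin

definition inner_ell2 :: "ell2 \<Rightarrow> ell2 \<Rightarrow> real" where "inner_ell2 x y = Re (cinner x y)"
definition norm_ell2 :: "ell2 \<Rightarrow> real" where "norm_ell2 x = sqrt (\<Sum>n. (cmod (coord x n))\<^sup>2)"
definition dist_ell2 :: "ell2 \<Rightarrow> ell2 \<Rightarrow> real" where "dist_ell2 x y = norm (x - y)"
definition sgn_ell2 :: "ell2 \<Rightarrow> ell2" where "sgn_ell2 x = x /\<^sub>R norm x"
definition uniformity_ell2 :: "(ell2 \<times> ell2) filter" where
  "uniformity_ell2 = (INF e\<in>{0 <..}. principal {(x, y). dist x y < e})"
definition open_ell2 :: "ell2 set \<Rightarrow> bool" where
  "open_ell2 S \<longleftrightarrow> (\<forall>x\<in>S. \<forall>\<^sub>F (x', y) in uniformity. x' = x \<longrightarrow> y \<in> S)"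

instance
proof
  fix r :: real and x y z :: ell2
  show "dist x y = norm (x - y)" by (rule dist_ell2_def)
  show "sgn x = x /\<^sub>R norm x" by (rule sgn_ell2_def)
  show "(uniformity :: (ell2 \<times> ell2) filter) = (INF e\<in>{0 <..}. principal {(x, y). dist x y < e})"
    by (rule uniformity_ell2_def)
  show "open S \<longleftrightarrow> (\<forall>x\<in>S. \<forall>\<^sub>F (x', y) in uniformity. x' = x \<longrightarrow> y \<in> S)" for S :: "ell2 set"
    by (rule open_ell2_def)
  show "inner x y = inner y x"
    by (simp add: inner_ell2_def cinner_commute[of x y])
  show "inner (x + y) z = inner x z + inner y z"
    by (simp add: inner_ell2_def cinner_add_left)
  show "inner (r *\<^sub>R x) y = r * inner x y"
    by (simp add: inner_ell2_def scaleR_ell2_def cinner_scale_left)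
  show "0 \<le> inner x x"
    by (simp add: inner_ell2_def cinner_self suminf_nonneg summable_coord)
  show "inner x x = 0 \<longleftrightarrow> x = 0"
  proof -
    have "inner x x = 0 \<longleftrightarrow> (\<forall>n. (cmod (coord x n))\<^sup>2 = 0)"
      unfolding inner_ell2_def cinner_self Re_complex_of_real
      by (rule suminf_eq_zero_iff[OF summable_coord]) simp
    also have "\<dots> \<longleftrightarrow> x = 0"
      using ell2_eqI[of x 0] by auto
    finally show ?thesis .
  qed
  show "norm x = sqrt (inner x x)"
    by (simp add: norm_ell2_def inner_ell2_def cinner_self)
qed

end

lift_definition basis :: "nat \<Rightarrow> ell2" is "\<lambda>n m. if m = n then 1 else 0"
  by (rule summable_finite[where N = "{_}"]) auto

lemma coord_basis: "coord (basis n) m = (if m = n then 1 else 0)"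
  by transfer simp

section \<open>Bounded operators\<close>

definition bounded_clinear :: "(ell2 \<Rightarrow> ell2) \<Rightarrow> bool" where
  "bounded_clinear A \<longleftrightarrow> bounded_linear A \<and> (\<forall>c x. A (c *\<^sub>C x) = c *\<^sub>C A x)"

typedef bop = "{A. bounded_clinear A}" morphisms app Abs_bop
  by (rule exI[of _ "\<lambda>_. 0"]) (simp add: bounded_clinear_def ell2_eqI)

setup_lifting type_definition_bop

lemma bop_eqI: "(\<And>x. app A x = app B x) \<Longrightarrow> A = B"
  by (simp add: app_inject[symmetric] fun_eq_iff)

lemma bounded_linear_app: "bounded_linear (app A)"
  using app[of A] by (simp add: bounded_clinear_def)

lemma app_add: "app A (x + y) = app A x + app A y"
  using bounded_linear_app by (rule linear_add[OF bounded_linear.linear])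

lemma app_scaleC: "app A (c *\<^sub>C x) = c *\<^sub>C app A x"
  using app[of A] by (simp add: bounded_clinear_def)

lemma bounded_clinearI:
  assumes "\<And>x y. A (x + y) = A x + A y" "\<And>c x. A (c *\<^sub>C x) = c *\<^sub>C A x"
    "\<And>x. norm (A x) \<le> K * norm x"
  shows "bounded_clinear A"
  unfolding bounded_clinear_def
  using assms by (auto intro!: bounded_linear_intro[where K = K] simp: scaleR_ell2_def mult.commute)

lemma norm_scaleC: "norm (c *\<^sub>C x :: ell2) = cmod c * norm x"
  using summable_coord[of x]
  by (simp add: norm_ell2_def norm_mult power_mult_distrib suminf_mult real_sqrt_mult)

lemma bounded_linear_scaleC: "bounded_linear (\<lambda>x :: ell2. c *\<^sub>C x)"
  by (rule bounded_linear_intro[where K = "cmod c"])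
     (simp_all add: scaleC_add_right scaleR_ell2_def scaleC_scaleC norm_scaleC mult.commute)

text \<open>The product on \<^typ>\<open>bop\<close> is composition.\<close>

instantiation bop :: "{complex_vector, ring_1}"
begin

lift_definition zero_bop :: bop is "\<lambda>_. 0"
  by (simp add: bounded_clinear_def ell2_eqI)
lift_definition one_bop :: bop is "\<lambda>x. x"
  by (simp add: bounded_clinear_def bounded_linear_ident)
lift_definition plus_bop :: "bop \<Rightarrow> bop \<Rightarrow> bop" is "\<lambda>A B x. A x + B x"
  by (simp add: bounded_clinear_def bounded_linear_add scaleC_add_right)
lift_definition uminus_bop :: "bop \<Rightarrow> bop" is "\<lambda>A x. - A x"
  by (auto simp: bounded_clinear_def bounded_linear_minus intro!: ell2_eqI)
lift_definition minus_bop :: "bop \<Rightarrow> bop \<Rightarrow> bop" is "\<lambda>A B x. A x - B x"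
  by (auto simp: bounded_clinear_def bounded_linear_sub right_diff_distrib intro!: ell2_eqI)
lift_definition times_bop :: "bop \<Rightarrow> bop \<Rightarrow> bop" is "\<lambda>A B x. A (B x)"
  by (simp add: bounded_clinear_def bounded_linear_compose)
lift_definition scaleC_bop :: "complex \<Rightarrow> bop \<Rightarrow> bop" is "\<lambda>c A x. c *\<^sub>C A x"
  by (simp add: bounded_clinear_def bounded_linear_compose[OF bounded_linear_scaleC]
      scaleC_scaleC mult.commute)

instance
proof
  have "app (0 :: bop) (basis 0) \<noteq> app 1 (basis 0)"
    using coord_basis[of 0 0] by (auto simp: zero_bop.rep_eq one_bop.rep_eq)
  then show "(0 :: bop) \<noteq> 1" by metis
qed (rule bop_eqI, simp add: zero_bop.rep_eq one_bop.rep_eq plus_bop.rep_eq uminus_bop.rep_eq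
    minus_bop.rep_eq times_bop.rep_eq scaleC_bop.rep_eq app_add scaleC_add_right scaleC_add_left
    scaleC_scaleC scaleC_one add.assoc add.commute)+

end

lemma app_simps [simp]:
  "app 0 x = 0" "app 1 x = x" "app (A + B) x = app A x + app B x"
  "app (- A) x = - app A x" "app (A - B) x = app A x - app B x"
  "app (A * B) x = app A (app B x)" "app (c *\<^sub>C A) x = c *\<^sub>C app A x"
  by (simp_all add: zero_bop.rep_eq one_bop.rep_eq plus_bop.rep_eq uminus_bop.rep_eq
      minus_bop.rep_eq times_bop.rep_eq scaleC_bop.rep_eq)

lemma cinner_basis_left: "cinner (basis n) x = coord x n"
proof -
  have "(\<lambda>m. cnj (coord (basis n) m) * coord x m) = (\<lambda>m. if m = n then coord x m else 0)"
    by (auto simp: coord_basis)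
  then show ?thesis
    using sums_unique[OF sums_single[of n "coord x"]] by (simp add: cinner_def)
qed

lemma cinner_basis_right: "cinner x (basis n) = cnj (coord x n)"
  by (simp only: cinner_commute[of x "basis n"] cinner_basis_left)

lemma cmod_cinner_le: "cmod (cinner x y) \<le> norm x * norm y"
proof (cases "cinner x y = 0")
  case False
  define c where "c = cnj (cinner x y) / cmod (cinner x y)"
  have "cmod c = 1" using False by (simp add: c_def norm_divide)
  have "c * cinner x y = cmod (cinner x y)"
    using False complex_norm_square[of "cinner x y"]
    by (simp add: c_def field_simps power2_eq_square)
  then have "cmod (cinner x y) = inner x (c *\<^sub>C y)"
    by (simp add: inner_ell2_def cinner_scale_right)
  also have "\<dots> \<le> norm x * norm (c *\<^sub>C y)" by (rule norm_cauchy_schwarz)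
  finally show ?thesis using \<open>cmod c = 1\<close> by (simp add: norm_scaleC)
qed simp

lemma bounded_linear_cinner: "bounded_linear (cinner x)"
  by (rule bounded_linear_intro[where K = "norm x"])
     (simp_all add: cinner_add_right scaleR_ell2_def cinner_scale_right scaleR_conv_of_real
        cmod_cinner_le mult.commute[of "norm _" "norm x"])

lemma coord_sum: "coord (\<Sum>i\<in>I. f i) n = (\<Sum>i\<in>I. coord (f i) n)"
  by (induction I rule: infinite_finite_induct) auto

lemma coord_sum_basis:
  "coord (\<Sum>i<N. c i *\<^sub>C basis i) m = (if m < N then c m else 0)"
proof -
  have "coord (\<Sum>i<N. c i *\<^sub>C basis i) m = (\<Sum>i<N. if i = m then c m else 0)"
    unfolding coord_sum by (rule sum.cong) (auto simp: coord_basis)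
  then show ?thesis by (simp add: sum.delta)
qed

lemma norm_sum_basis: "(norm (\<Sum>i<N. c i *\<^sub>C basis i))\<^sup>2 = (\<Sum>i<N. (cmod (c i))\<^sup>2)"
proof -
  let ?w = "\<Sum>i<N. c i *\<^sub>C basis i"
  have "(norm ?w)\<^sup>2 = (\<Sum>n. (cmod (coord ?w n))\<^sup>2)"
    by (simp add: norm_ell2_def suminf_nonneg summable_coord)
  also have "\<dots> = (\<Sum>n<N. (cmod (coord ?w n))\<^sup>2)"
    by (rule suminf_finite) (auto simp: coord_sum_basis)
  finally show ?thesis by (simp add: coord_sum_basis)
qed

lemma basis_expansion: "(\<lambda>n. coord y n *\<^sub>C basis n) sums y"
proof -
  let ?w = "\<lambda>N. \<Sum>i<N. coord y i *\<^sub>C basis i"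
  let ?f = "\<lambda>n. (cmod (coord y n))\<^sup>2"
  have eq: "(norm (y - ?w N))\<^sup>2 = suminf ?f - (\<Sum>n<N. ?f n)" for N
  proof -
    have "(norm (y - ?w N))\<^sup>2 = (\<Sum>n. (cmod (coord (y - ?w N) n))\<^sup>2)"
      by (simp add: norm_ell2_def suminf_nonneg summable_coord del: coord_simps)
    also have "\<dots> = (\<Sum>n. (cmod (coord (y - ?w N) (n + N)))\<^sup>2)"
      by (subst suminf_split_initial_segment[OF summable_coord, of _ N])
         (simp add: coord_sum_basis)
    also have "\<dots> = (\<Sum>n. ?f (n + N))" by (simp add: coord_sum_basis)
    finally show ?thesis
      by (simp add: suminf_minus_initial_segment[OF summable_coord])
  qed
  have "(\<lambda>N. suminf ?f - (\<Sum>n<N. ?f n)) \<longlonglongrightarrow> suminf ?f - suminf ?f"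
    by (intro tendsto_intros summable_LIMSEQ summable_coord)
  then have "(\<lambda>N. (norm (y - ?w N))\<^sup>2) \<longlonglongrightarrow> 0"
    by (simp only: eq diff_self)
  from tendsto_real_sqrt[OF this] have "(\<lambda>N. norm (y - ?w N)) \<longlonglongrightarrow> 0"
    by (simp only: real_sqrt_abs real_sqrt_zero abs_norm_cancel)
  then have "(\<lambda>N. y - ?w N) \<longlonglongrightarrow> 0" by (rule tendsto_norm_zero_cancel)
  then have "(\<lambda>N. y - (y - ?w N)) \<longlonglongrightarrow> y - 0" by (intro tendsto_diff tendsto_const)
  then show ?thesis by (simp add: sums_def)
qed

definition adj :: "bop \<Rightarrow> bop" where
  "adj A = (THE B. \<forall>x y. cinner (app B x) y = cinner x (app A y))"

lemma adj_exists: "\<exists>B. \<forall>x y. cinner (app B x) y = cinner x (app A y)"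
proof -
  obtain K where K: "\<And>x. norm (app A x) \<le> norm x * K" "K \<ge> 0"
    using bounded_linear.nonneg_bounded[OF bounded_linear_app[of A]] by auto
  let ?c = "\<lambda>x n. cinner (app A (basis n)) x"
  have bd: "(\<Sum>n<N. (cmod (?c x n))\<^sup>2) \<le> (K * norm x)\<^sup>2" for x N
  proof -
    let ?w = "\<Sum>n<N. ?c x n *\<^sub>C basis n"
    have "app A ?w = (\<Sum>n<N. ?c x n *\<^sub>C app A (basis n))"
      by (simp add: linear_sum[OF bounded_linear.linear[OF bounded_linear_app]] app_scaleC)
    then have "cinner x (app A ?w) = (\<Sum>n<N. ?c x n * cinner x (app A (basis n)))"
      by (simp add: linear_sum[OF bounded_linear.linear[OF bounded_linear_cinner]]
          cinner_scale_right)
    also have "\<dots> = (\<Sum>n<N. of_real ((cmod (?c x n))\<^sup>2))"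
      by (simp only: cinner_commute[of x "app A _"] complex_norm_square)
    also have "\<dots> = of_real ((norm ?w)\<^sup>2)" by (simp add: norm_sum_basis)
    finally have "(norm ?w)\<^sup>2 = cmod (cinner x (app A ?w))" by (simp add: norm_power)
    also have "\<dots> \<le> norm x * (norm ?w * K)"
      using K by (intro order_trans[OF cmod_cinner_le] mult_left_mono) auto
    finally have le: "norm ?w * norm ?w \<le> norm ?w * (K * norm x)"
      by (simp only: power2_eq_square mult_ac)
    have "0 < norm ?w \<or> norm ?w = 0" using norm_ge_zero[of ?w] by linarith
    then have "norm ?w \<le> K * norm x"
    proof
      assume "0 < norm ?w"
      then show ?thesis by (rule mult_left_le_imp_le[OF le])
    next
      assume "norm ?w = 0"
      then show ?thesis using K(2) mult_nonneg_nonneg[OF K(2) norm_ge_zero[of x]] by linarith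
    qed
    then show ?thesis by (simp add: norm_sum_basis[symmetric] power_mono)
  qed
  have sm: "summable (\<lambda>n. (cmod (?c x n))\<^sup>2)" for x
    using bd[of x] by (intro summableI_nonneg_bounded) auto
  define B where "B x = Abs_ell2 (?c x)" for x
  have coordB: "coord (B x) = ?c x" for x
    using sm[of x] by (simp add: B_def Abs_ell2_inverse)
  have "norm (B x) \<le> K * norm x" for x
  proof -
    have "(\<Sum>n. (cmod (?c x n))\<^sup>2) \<le> (K * norm x)\<^sup>2"
      by (intro suminf_le_const sm bd)
    then show ?thesis using K(2) by (simp add: norm_ell2_def[of "B x"] coordB real_le_lsqrt)
  qed
  then have "bounded_clinear B"
    by (intro bounded_clinearI[where K = K])
       (auto intro!: ell2_eqI simp: coordB cinner_add_right cinner_scale_right)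
  then have app: "app (Abs_bop B) = B" by (simp add: Abs_bop_inverse)
  have "cinner (B x) y = cinner x (app A y)" for x y
  proof -
    have "(\<lambda>n. cinner x (app A (coord y n *\<^sub>C basis n))) sums cinner x (app A y)"
      by (intro bounded_linear.sums[OF bounded_linear_cinner]
          bounded_linear.sums[OF bounded_linear_app] basis_expansion)
    then show ?thesis
      by (simp add: cinner_def[of "B x"] coordB sums_iff app_scaleC cinner_scale_right
          cinner_commute[of x "app A _"] mult.commute)
  qed
  then show ?thesis using app by metis
qed

lemma cinner_adj: "cinner (app (adj A) x) y = cinner x (app A y)"
proof -
  have "B = C" if "\<forall>x y. cinner (app B x) y = cinner x (app A y)"
    "\<forall>x y. cinner (app C x) y = cinner x (app A y)" for B C
  proof (intro bop_eqI ell2_eqI)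
    fix x n
    have "cinner (app B x) (basis n) = cinner (app C x) (basis n)" using that by simp
    then show "coord (app B x) n = coord (app C x) n" by (simp add: cinner_basis_right)
  qed
  then have "\<exists>!B. \<forall>x y. cinner (app B x) y = cinner x (app A y)"
    using adj_exists[of A] by blast
  from theI'[OF this] show ?thesis by (simp add: adj_def)
qed

definition positive_op :: "bop \<Rightarrow> bool" where
  "positive_op A \<longleftrightarrow> (\<forall>x. cinner x (app A x) \<in> \<real>\<^sub>\<ge>\<^sub>0)"

definition projection :: "bop \<Rightarrow> bool" where
  "projection p \<longleftrightarrow> adj p = p \<and> p * p = p"

text \<open>\<open>A\<close> is trace class if its absolute value, i.e. the positive square root \<open>P\<close> of
  \<open>A\<^sup>* A\<close>, has finite trace.\<close>

definition trace_class :: "bop \<Rightarrow> bool" where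
  "trace_class A \<longleftrightarrow> (\<exists>P. positive_op P \<and> P * P = adj A * A \<and>
     summable (\<lambda>n. cinner (basis n) (app P (basis n))))"

definition op_trace :: "bop \<Rightarrow> complex" where
  "op_trace A = (\<Sum>n. cinner (basis n) (app A (basis n)))"

text \<open>The value \<open>0\<close> for unbounded \<open>d\<close> is a dummy.\<close>

lift_definition diag_op :: "(nat \<Rightarrow> real) \<Rightarrow> bop" is
  "\<lambda>d x. if bounded (range d) then Abs_ell2 (\<lambda>n. of_real (d n) * coord x n) else 0"
proof -
  fix d :: "nat \<Rightarrow> real"
  show "bounded_clinear (\<lambda>x. if bounded (range d)
    then Abs_ell2 (\<lambda>n. of_real (d n) * coord x n) else 0)"
  proof (cases "bounded (range d)")
    case True
    then obtain K where K: "\<And>n. \<bar>d n\<bar> \<le> K" by (auto simp: bounded_iff)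
    then have "K \<ge> 0" by (meson abs_ge_zero order_trans)
    have le: "(cmod (of_real (d n) * coord x n))\<^sup>2 \<le> K\<^sup>2 * (cmod (coord x n))\<^sup>2" for x n
      using power_mono[OF K[of n], of 2]
      by (simp add: norm_mult power_mult_distrib mult_right_mono)
    have sm: "summable (\<lambda>n. (cmod (of_real (d n) * coord x n))\<^sup>2)" for x
      by (rule summable_comparison_test'[OF summable_mult[OF summable_coord[of x], of "K\<^sup>2"]])
         (use le in auto)
    define D where "D x = Abs_ell2 (\<lambda>n. of_real (d n) * coord x n)" for x
    have coordD: "coord (D x) = (\<lambda>n. of_real (d n) * coord x n)" for x
      using sm[of x] by (simp add: D_def Abs_ell2_inverse)
    have "norm (D x) \<le> K * norm x" for x
    proof -
      have "(\<Sum>n. (cmod (of_real (d n) * coord x n))\<^sup>2) \<le> K\<^sup>2 * (\<Sum>n. (cmod (coord x n))\<^sup>2)"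
        by (subst suminf_mult[OF summable_coord, symmetric])
           (intro suminf_le le sm summable_mult summable_coord)
      then have "norm (D x) \<le> sqrt (K\<^sup>2 * (\<Sum>n. (cmod (coord x n))\<^sup>2))"
        unfolding norm_ell2_def[of "D x"] coordD by (rule real_sqrt_le_mono)
      then show ?thesis using \<open>K \<ge> 0\<close> by (simp add: norm_ell2_def[of x] real_sqrt_mult)
    qed
    then have "bounded_clinear D"
      by (intro bounded_clinearI[where K = K])
         (auto intro!: ell2_eqI simp: coordD algebra_simps)
    then show ?thesis using True by (simp add: D_def[abs_def])
  qed (simp add: bounded_clinear_def ell2_eqI)
qed

lemma app_diag_basis:
  assumes "bounded (range d)"
  shows "app (diag_op d) (basis n) = of_real (d n) *\<^sub>C basis n"
proof -
  have "(\<lambda>m. of_real (d m) * coord (basis n) m) = coord (of_real (d n) *\<^sub>C basis n)"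
    by (auto simp: coord_basis)
  then show ?thesis using assms by (simp add: diag_op.rep_eq coord_inverse)
qed

lift_definition shift :: bop is
  "\<lambda>x. Abs_ell2 (\<lambda>n. case n of 0 \<Rightarrow> 0 | Suc m \<Rightarrow> coord x m)"
proof -
  let ?f = "\<lambda>x n. case n of 0 \<Rightarrow> 0 | Suc m \<Rightarrow> coord x m"
  have sm: "summable (\<lambda>n. (cmod (?f x n))\<^sup>2)" for x
    by (subst summable_Suc_iff[symmetric]) (simp add: summable_coord)
  define S where "S x = Abs_ell2 (?f x)" for x
  have coordS: "coord (S x) = ?f x" for x
    using sm[of x] by (simp add: S_def Abs_ell2_inverse)
  have "norm (S x) \<le> 1 * norm x" for x
    using suminf_split_head[OF sm[of x]] by (simp add: norm_ell2_def coordS)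
  then have "bounded_clinear S"
    by (intro bounded_clinearI[where K = 1])
       (auto intro!: ell2_eqI simp: coordS split: nat.split)
  then show "bounded_clinear (\<lambda>x. Abs_ell2 (?f x))" by (simp add: S_def[abs_def])
qed

lemma app_shift_basis: "app shift (basis n) = basis (Suc n)"
proof -
  have "(\<lambda>k. case k of 0 \<Rightarrow> 0 | Suc m \<Rightarrow> coord (basis n) m) = coord (basis (Suc n))"
    by (auto simp: coord_basis split: nat.split)
  then show ?thesis by (simp add: shift.rep_eq coord_inverse)
qed

lemma coord_diag:
  assumes "\<And>n. \<bar>d n\<bar> \<le> K"
  shows "coord (app (diag_op d) x) n = of_real (d n) * coord x n"
proof -
  have "bounded (range d)" using assms by (auto simp: bounded_iff)
  moreover have "(cmod (of_real (d n) * coord x n))\<^sup>2 \<le> K\<^sup>2 * (cmod (coord x n))\<^sup>2" for n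
    using power_mono[OF assms[of n], of 2]
    by (simp add: norm_mult power_mult_distrib mult_right_mono)
  then have "summable (\<lambda>n. (cmod (of_real (d n) * coord x n))\<^sup>2)"
    by (intro summable_comparison_test'[OF summable_mult[OF summable_coord[of x], of "K\<^sup>2"]]) auto
  ultimately show ?thesis by (simp add: diag_op.rep_eq Abs_ell2_inverse)
qed

lemma coord_shift: "coord (app shift x) n = (case n of 0 \<Rightarrow> 0 | Suc m \<Rightarrow> coord x m)"
proof -
  have "summable (\<lambda>n. (cmod (case n of 0 \<Rightarrow> 0 | Suc m \<Rightarrow> coord x m))\<^sup>2)"
    by (subst summable_Suc_iff[symmetric]) (simp add: summable_coord)
  then show ?thesis by (simp add: shift.rep_eq Abs_ell2_inverse)
qed

lemma coord_adj: "coord (app (adj A) x) n = cinner (app A (basis n)) x"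
proof -
  have "cinner (app (adj A) x) (basis n) = cinner x (app A (basis n))" by (rule cinner_adj)
  then have "cnj (coord (app (adj A) x) n) = cnj (cinner (app A (basis n)) x)"
    by (simp only: cinner_basis_right cinner_commute[of x "app A (basis n)"])
  then show ?thesis by simp
qed

lemma coord_adj_shift: "coord (app (adj shift) x) n = coord x (Suc n)"
  by (simp add: coord_adj app_shift_basis cinner_basis_left)

lemma adj_unique:
  assumes "\<And>x y. cinner (app B x) y = cinner x (app A y)"
  shows "adj A = B"
proof (intro bop_eqI ell2_eqI)
  fix x n
  have "cinner (app (adj A) x) (basis n) = cinner (app B x) (basis n)"
    by (simp add: cinner_adj assms)
  then show "coord (app (adj A) x) n = coord (app B x) n" by (simp add: cinner_basis_right)
qed

lemma adj_adj: "adj (adj A) = A"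
proof (rule adj_unique)
  show "cinner (app A x) y = cinner x (app (adj A) y)" for x y
    by (simp only: cinner_commute[of x "app (adj A) y"] cinner_commute[of "app A x" y] cinner_adj)
qed

lemma adj_mult: "adj (A * B) = adj B * adj A"
  by (rule adj_unique) (simp add: cinner_adj)

lemma adj_scaleC: "adj (c *\<^sub>C A) = cnj c *\<^sub>C adj A"
  by (rule adj_unique) (simp add: cinner_adj cinner_scale_left cinner_scale_right)

lemma adj_diag:
  assumes "\<And>n. \<bar>d n\<bar> \<le> K"
  shows "adj (diag_op d) = diag_op d"
  using assms
  by (intro adj_unique) (simp add: cinner_def coord_diag[of d K] mult_ac)

section \<open>States\<close>

definition cmat_scale :: "complex \<Rightarrow> complex^2^2 \<Rightarrow> complex^2^2" where
  "cmat_scale c y = (\<chi> i j. c * y $ i $ j)"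

definition cmat_adj :: "complex^2^2 \<Rightarrow> complex^2^2" where
  "cmat_adj y = (\<chi> i j. cnj (y $ j $ i))"

definition state_M2 :: "(complex^2^2 \<Rightarrow> complex) \<Rightarrow> bool" where
  "state_M2 \<psi> \<longleftrightarrow>
     (\<forall>x y. \<psi> (x + y) = \<psi> x + \<psi> y) \<and> (\<forall>c x. \<psi> (cmat_scale c x) = c * \<psi> x) \<and>
     (\<forall>x. \<psi> (cmat_adj x ** x) \<in> \<real>\<^sub>\<ge>\<^sub>0) \<and> \<psi> (mat 1) = 1"

definition faithful_M2 :: "(complex^2^2 \<Rightarrow> complex) \<Rightarrow> bool" where
  "faithful_M2 \<psi> \<longleftrightarrow> (\<forall>x. \<psi> (cmat_adj x ** x) = 0 \<longrightarrow> x = 0)"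

definition state_B :: "(bop \<Rightarrow> complex) \<Rightarrow> bool" where
  "state_B \<phi> \<longleftrightarrow>
     (\<forall>x y. \<phi> (x + y) = \<phi> x + \<phi> y) \<and> (\<forall>c x. \<phi> (c *\<^sub>C x) = c * \<phi> x) \<and>
     (\<forall>x. \<phi> (adj x * x) \<in> \<real>\<^sub>\<ge>\<^sub>0) \<and> \<phi> 1 = 1"

definition normal_state :: "(bop \<Rightarrow> complex) \<Rightarrow> bool" where
  "normal_state \<phi> \<longleftrightarrow>
     state_B \<phi> \<and> (\<exists>\<rho>. trace_class \<rho> \<and> (\<forall>x. \<phi> x = op_trace (\<rho> * x)))"

definition invariant_state :: "(bop \<Rightarrow> bop) \<Rightarrow> (bop \<Rightarrow> complex) \<Rightarrow> bool" where
  "invariant_state T \<phi> \<longleftrightarrow> \<phi> \<circ> T = \<phi>"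

section \<open>The transition operator\<close>

text \<open>Operators on \<open>\<H> \<otimes> \<complex>\<^sup>2\<close> are \<open>2 \<times> 2\<close> matrices over \<^typ>\<open>bop\<close>.\<close>

definition bmat_adj :: "bop^2^2 \<Rightarrow> bop^2^2" where
  "bmat_adj X = (\<chi> i j. adj (X $ j $ i))"

definition bmat_scale :: "complex \<Rightarrow> bop^2^2 \<Rightarrow> bop^2^2" where
  "bmat_scale c X = (\<chi> i j. c *\<^sub>C X $ i $ j)"

definition tensor :: "bop \<Rightarrow> complex^2^2 \<Rightarrow> bop^2^2" where
  "tensor x y = (\<chi> i j. (y $ i $ j) *\<^sub>C x)"

definition unit_mat :: "2 \<Rightarrow> 2 \<Rightarrow> complex^2^2" where
  "unit_mat k l = (\<chi> i j. if i = k \<and> j = l then 1 else 0)"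

text \<open>Since \<open>X = (\<Sum>k l. tensor (X $ k $ l) (unit_mat k l))\<close>, this is the linear extension of
  \<open>tensor x y \<mapsto> \<psi> y *\<^sub>C x\<close>; see \<open>slice_tensor\<close> and \<open>slice_unique\<close> below.\<close>

definition slice :: "(complex^2^2 \<Rightarrow> complex) \<Rightarrow> bop^2^2 \<Rightarrow> bop" where
  "slice \<psi> X = (\<Sum>k\<in>UNIV. \<Sum>l\<in>UNIV. \<psi> (unit_mat k l) *\<^sub>C X $ k $ l)"

lemma slice_linear:
  "slice \<psi> (X + Y) = slice \<psi> X + slice \<psi> Y" "slice \<psi> (bmat_scale c X) = c *\<^sub>C slice \<psi> X"
  by (simp_all add: slice_def bmat_scale_def sum_2 scaleC_add_right scaleC_scaleC mult.commute
      add_ac)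

lemma slice_tensor:
  assumes "state_M2 \<psi>"
  shows "slice \<psi> (tensor x y) = \<psi> y *\<^sub>C x"
proof -
  have "y = cmat_scale (y$1$1) (unit_mat 1 1) + cmat_scale (y$1$2) (unit_mat 1 2)
    + cmat_scale (y$2$1) (unit_mat 2 1) + cmat_scale (y$2$2) (unit_mat 2 2)"
    by (simp add: vec_eq_iff forall_2 cmat_scale_def unit_mat_def)
  then have "\<psi> y = y$1$1 * \<psi> (unit_mat 1 1) + y$1$2 * \<psi> (unit_mat 1 2)
    + y$2$1 * \<psi> (unit_mat 2 1) + y$2$2 * \<psi> (unit_mat 2 2)"
    using assms unfolding state_M2_def by metis
  then show ?thesis
    by (simp add: slice_def tensor_def sum_2 scaleC_scaleC scaleC_add_left mult.commute add_ac)
qed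

lemma slice_unique:
  assumes "\<And>X Y. P (X + Y) = P X + P Y" "\<And>x y. P (tensor x y) = \<psi> y *\<^sub>C x"
  shows "P = slice \<psi>"
proof
  fix X :: "bop^2^2"
  have 0: "(0::complex) *\<^sub>C A = 0" for A :: bop
    using scaleC_add_left[of 0 0 A] by simp
  have "X = tensor (X$1$1) (unit_mat 1 1) + tensor (X$1$2) (unit_mat 1 2)
    + tensor (X$2$1) (unit_mat 2 1) + tensor (X$2$2) (unit_mat 2 2)"
    by (simp add: vec_eq_iff forall_2 tensor_def unit_mat_def scaleC_one 0)
  then have "P X = \<psi> (unit_mat 1 1) *\<^sub>C X$1$1 + \<psi> (unit_mat 1 2) *\<^sub>C X$1$2
    + \<psi> (unit_mat 2 1) *\<^sub>C X$2$1 + \<psi> (unit_mat 2 2) *\<^sub>C X$2$2"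
    using assms by metis
  then show "P X = slice \<psi> X" by (simp add: slice_def sum_2 add_ac)
qed

definition walk_unitary :: "(nat \<Rightarrow> real) \<Rightarrow> (nat \<Rightarrow> real) \<Rightarrow> bop^2^2" where
  "walk_unitary \<alpha> \<beta> =
     (let a = diag_op \<alpha>; b = diag_op \<beta>; s = shift
      in vector [vector [adj s * a * s, \<i> *\<^sub>C (adj s * b)],
                 vector [\<i> *\<^sub>C (b * s), a]])"

lemma walk_unitary_unitary:
  assumes "\<And>n. (\<alpha> n)\<^sup>2 + (\<beta> n)\<^sup>2 = 1" "\<alpha> 0 = 1"
  shows "bmat_adj (walk_unitary \<alpha> \<beta>) ** walk_unitary \<alpha> \<beta> = mat 1"
    "walk_unitary \<alpha> \<beta> ** bmat_adj (walk_unitary \<alpha> \<beta>) = mat 1"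
proof -
  have le: "\<bar>\<alpha> n\<bar> \<le> 1" "\<bar>\<beta> n\<bar> \<le> 1" for n
  proof -
    have "(\<alpha> n)\<^sup>2 \<le> 1" "(\<beta> n)\<^sup>2 \<le> 1"
      using assms(1)[of n] zero_le_power2[of "\<alpha> n"] zero_le_power2[of "\<beta> n"] by linarith+
    then show "\<bar>\<alpha> n\<bar> \<le> 1" "\<bar>\<beta> n\<bar> \<le> 1" by (simp_all add: abs_square_le_1)
  qed
  have \<beta>0: "\<beta> 0 = 0" using assms(1)[of 0] assms(2) by simp
  have "z * (complex_of_real (\<alpha> n) * complex_of_real (\<alpha> n)) +
      z * (complex_of_real (\<beta> n) * complex_of_real (\<beta> n))
      = z * of_real ((\<alpha> n)\<^sup>2 + (\<beta> n)\<^sup>2)" for n z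
    by (simp add: power2_eq_square algebra_simps)
  then have sq: "z * (complex_of_real (\<alpha> n) * complex_of_real (\<alpha> n)) +
      z * (complex_of_real (\<beta> n) * complex_of_real (\<beta> n)) = z" for n z
    by (simp add: assms(1))
  then have sq': "z * (complex_of_real (\<beta> n) * complex_of_real (\<beta> n)) +
      z * (complex_of_real (\<alpha> n) * complex_of_real (\<alpha> n)) = z" for n z
    by (simp only: add.commute)
  note s = bmat_adj_def walk_unitary_def Let_def matrix_matrix_mult_def mat_def vec_eq_iff
    forall_2 sum_2 adj_mult adj_scaleC adj_adj adj_diag[OF le(1)] adj_diag[OF le(2)]
  note c = coord_diag[OF le(1)] coord_diag[OF le(2)] coord_shift coord_adj_shift
  show "bmat_adj (walk_unitary \<alpha> \<beta>) ** walk_unitary \<alpha> \<beta> = mat 1"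
    by (auto simp: s intro!: bop_eqI ell2_eqI)
       (auto simp: c sq sq' \<beta>0 assms(2) mult_ac app_scaleC split: nat.split)
  show "walk_unitary \<alpha> \<beta> ** bmat_adj (walk_unitary \<alpha> \<beta>) = mat 1"
    by (auto simp: s intro!: bop_eqI ell2_eqI)
       (auto simp: c sq sq' \<beta>0 assms(2) mult_ac app_scaleC split: nat.split)
qed

definition transition ::
  "(nat \<Rightarrow> real) \<Rightarrow> (nat \<Rightarrow> real) \<Rightarrow> (complex^2^2 \<Rightarrow> complex) \<Rightarrow> bop \<Rightarrow> bop" where
  "transition \<alpha> \<beta> \<psi> x =
     (let u = walk_unitary \<alpha> \<beta> in slice \<psi> (bmat_adj u ** tensor x (mat 1) ** u))"

section \<open>Ergodic properties\<close>

definition subharmonic :: "(bop \<Rightarrow> bop) \<Rightarrow> bop \<Rightarrow> bool" where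
  "subharmonic T p \<longleftrightarrow> projection p \<and> positive_op (T p - p)"

definition irreducible_map :: "(bop \<Rightarrow> bop) \<Rightarrow> bool" where
  "irreducible_map T \<longleftrightarrow> (\<forall>p. subharmonic T p \<longrightarrow> p = 0 \<or> p = 1)"

definition weakly_mixing :: "(bop \<Rightarrow> bop) \<Rightarrow> bool" where
  "weakly_mixing T \<longleftrightarrow>
     (\<forall>\<mu> x. cmod \<mu> = 1 \<and> T x = \<mu> *\<^sub>C x \<longrightarrow> (\<exists>c. x = c *\<^sub>C 1))"

end

theory Submission
  imports Defs
begin

text \<open>
  Write \<open>u = (u\<^sub>j\<^sub>k)\<close> and let \<open>H = (\<psi> E\<^sub>k\<^sub>l)\<close> be the matrix of values of \<open>\<psi>\<close> on the matrix units, so that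
  \<open>T x = \<Sum>\<^sub>j \<Sum>\<^sub>k\<^sub>l H\<^sub>k\<^sub>l u\<^sub>j\<^sub>k\<^sup>* x u\<^sub>j\<^sub>l\<close>. Faithfulness of \<open>\<psi>\<close> means that \<open>H\<close> is positive definite.
  Completing the square in \<open>H\<close> shows, for every positive functional \<open>f\<close> and every matrix \<open>A\<close> of
  operators, that \<open>f (\<Sum>\<^sub>j \<Sum>\<^sub>k\<^sub>l H\<^sub>k\<^sub>l A\<^sub>j\<^sub>k\<^sup>* A\<^sub>j\<^sub>l) \<ge> 0\<close>, and that equality forces \<open>f (A\<^sub>j\<^sub>k\<^sup>* A\<^sub>j\<^sub>k) = 0\<close> for
  all \<open>j, k\<close> (\<open>slice_null\<close>). This reduces everything to statements about the four entries of \<open>u\<close>.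

  Irreducibility. If \<open>T p \<ge> p\<close> and \<open>q = 1 - p\<close>, then \<open>T q \<le> q\<close>, so the vector functional of any \<open>\<xi>\<close> in
  the range of \<open>p\<close> vanishes on \<open>T q\<close>, whence \<open>q u\<^sub>j\<^sub>k \<xi> = 0\<close>: the range of \<open>p\<close> is invariant under all
  \<open>u\<^sub>j\<^sub>k\<close>. A closed set that is stable under scalars and under \<open>a\<close>, \<open>bs\<close> and \<open>s\<^sup>*b\<close> and that contains a
  nonzero vector contains all basis vectors (\<open>walk_invariant_set_contains_basis\<close>): \<open>s\<^sup>*b\<close> lowers
  indices until the zeroth coordinate is nonzero, powers of \<open>a\<close> converge strongly to the projection
  onto \<open>e\<^sub>0\<close> because \<open>|\<alpha>\<^sub>n| < 1\<close> for \<open>n \<ge> 1\<close>, and \<open>bs\<close> climbs from \<open>e\<^sub>0\<close> to every \<open>e\<^sub>n\<close>.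

  A normal invariant state \<open>\<phi> = Tr(\<rho> \<cdot>)\<close> is faithful. Indeed, if \<open>\<phi> (A\<^sup>* A) = 0\<close> with \<open>A \<noteq> 0\<close>, then
  multiplying by operators of rank one from the left gives a nonzero \<open>\<zeta>\<close> with \<open>\<langle>\<zeta>, \<rho> \<zeta>\<rangle> = 0\<close>. By
  invariance and \<open>slice_null\<close>, the set of these \<open>\<zeta>\<close> is invariant under all \<open>u\<^sub>j\<^sub>k\<^sup>*\<close>, so it contains every
  \<open>e\<^sub>n\<close>, and \<open>\<phi> 1 = \<Sum>\<^sub>n \<langle>e\<^sub>n, \<rho> e\<^sub>n\<rangle> = 0\<close>, which is absurd.

  Weak mixing. Let \<open>T x = \<mu> x\<close> with \<open>|\<mu>| = 1\<close>. The Kadison-Schwarz defect \<open>T (x\<^sup>* x) - (T x)\<^sup>* T x\<close> is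
  \<open>\<Sum>\<^sub>j \<Sum>\<^sub>k\<^sub>l H\<^sub>k\<^sub>l A\<^sub>j\<^sub>k\<^sup>* A\<^sub>j\<^sub>l\<close> for \<open>A\<^sub>j\<^sub>k = x u\<^sub>j\<^sub>k - u\<^sub>j\<^sub>k T x\<close> (\<open>slice_defect\<close>). It equals \<open>T (x\<^sup>* x) - x\<^sup>* x\<close>, on
  which \<open>\<phi>\<close> vanishes, so faithfulness of \<open>\<phi>\<close> gives \<open>x u\<^sub>j\<^sub>k = \<mu> u\<^sub>j\<^sub>k x\<close>. Since \<open>e\<^sub>0\<close> spans the kernel of
  \<open>s\<^sup>*b\<close>, the operator \<open>x\<close> maps \<open>e\<^sub>0\<close> to some \<open>c e\<^sub>0\<close>; then \<open>a e\<^sub>0 = e\<^sub>0\<close> gives \<open>\<mu> c = c\<close>, and applying \<open>bs\<close>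
  repeatedly yields \<open>x e\<^sub>n = c e\<^sub>n\<close> for all \<open>n\<close>.
\<close>

section \<open>Bounded operators\<close>

lemma adj_add: "adj (A + B) = adj A + adj B"
  by (rule adj_unique) (simp add: cinner_adj cinner_add_left cinner_add_right)

lemma scaleC_zero_left [simp]: "0 *\<^sub>C (x :: 'a :: complex_vector) = 0"
  using scaleC_add_left[of 0 0 x] by simp

lemma scaleC_minus_one: "(-1) *\<^sub>C (x :: 'a :: complex_vector) = - x"
  using scaleC_add_left[of 1 "-1" x] by (simp add: scaleC_one eq_neg_iff_add_eq_0 add.commute)

lemma mult_scaleC_left: "(c *\<^sub>C A) * B = c *\<^sub>C (A * B :: bop)"
  by (rule bop_eqI) simp

lemma mult_scaleC_right: "A * (c *\<^sub>C B) = c *\<^sub>C (A * B :: bop)"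
  by (rule bop_eqI) (simp add: app_scaleC)

lemma adj_one [simp]: "adj 1 = 1"
  by (rule adj_unique) simp

lemma adj_minus: "adj (A - B) = adj A - adj B"
proof -
  have "A - B = A + (-1) *\<^sub>C B" by (simp add: scaleC_minus_one)
  then show ?thesis by (simp only: adj_add adj_scaleC) (simp add: scaleC_minus_one)
qed

lemma bop_eq_on_basis:
  assumes "\<And>n. app A (basis n) = app B (basis n)"
  shows "A = B"
proof (rule bop_eqI)
  fix x
  have "(\<lambda>n. app C (coord x n *\<^sub>C basis n)) sums app C x" for C
    by (intro bounded_linear.sums[OF bounded_linear_app] basis_expansion)
  from this[of A] this[of B] show "app A x = app B x"
    by (simp add: app_scaleC assms sums_unique2)
qed

lemma cinner_self_eq_0: "cinner x x = 0 \<Longrightarrow> x = 0"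
  using inner_eq_zero_iff[of x] by (simp add: inner_ell2_def)

lemma cinner_self_nonneg: "cinner x x \<in> \<real>\<^sub>\<ge>\<^sub>0"
  by (simp add: cinner_self suminf_nonneg summable_coord)

lemma cinner_inner: "cinner x y = of_real (inner x y) - \<i> * of_real (inner x (\<i> *\<^sub>C y))"
  by (simp add: complex_eq_iff inner_ell2_def cinner_scale_right)

lemma continuous_on_cinner [continuous_intros]:
  assumes "continuous_on S f" "continuous_on S g"
  shows "continuous_on S (\<lambda>x. cinner (f x) (g x))"
  unfolding cinner_inner
  by (intro continuous_intros assms
      continuous_on_compose2[OF linear_continuous_on[OF bounded_linear_scaleC] assms(2)]) auto

text \<open>The rank-one operator \<open>|e\<^sub>0\<rangle>\<langle>\<zeta>|\<close>; the fixed unit vector \<open>e\<^sub>0\<close> turns the functional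
  \<open>\<langle>\<zeta>, \<cdot>\<rangle>\<close> into an operator on the same space, and \<open>|\<zeta>\<rangle>\<langle>\<zeta>|\<close> into a square.\<close>

lift_definition bra :: "ell2 \<Rightarrow> bop" is "\<lambda>\<zeta> x. cinner \<zeta> x *\<^sub>C basis 0"
proof -
  fix \<zeta>
  have "norm (cinner \<zeta> x *\<^sub>C basis 0) \<le> norm \<zeta> * norm (basis 0) * norm x" for x
    using mult_right_mono[OF cmod_cinner_le[of \<zeta> x], of "norm (basis 0)"]
    by (simp add: norm_scaleC mult_ac)
  then show "bounded_clinear (\<lambda>x. cinner \<zeta> x *\<^sub>C basis 0)"
    by (intro bounded_clinearI)
       (auto simp: cinner_add_right cinner_scale_right scaleC_add_left scaleC_scaleC)
qed

lemma app_bra: "app (bra \<zeta>) x = cinner \<zeta> x *\<^sub>C basis 0"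
  by (simp add: bra.rep_eq)

lemma bra_mult: "bra \<zeta> * A = bra (app (adj A) \<zeta>)"
  by (rule bop_eqI) (simp add: app_bra cinner_adj)

lemma app_adj_bra_bra: "app (adj (bra \<zeta>)) (app (bra \<zeta>) x) = cinner \<zeta> x *\<^sub>C \<zeta>"
  by (rule ell2_eqI)
    (simp add: coord_adj app_bra cinner_scale_left cinner_scale_right cinner_basis_right
      cinner_basis_left coord_basis)

section \<open>Invariant sets of the walk\<close>

text \<open>The squared distance to the limit is \<open>\<Sum>\<^sub>n\<^sub>\<ge>\<^sub>1 |d\<^sub>n|\<^sup>2\<^sup>k |\<zeta>\<^sub>n|\<^sup>2\<close>. Each term tends to \<open>0\<close> and all are
  dominated by \<open>|\<zeta>\<^sub>n|\<^sup>2\<close>, so Tannery's theorem applies, although the \<open>|d\<^sub>n|\<close> may accumulate at \<open>1\<close>.\<close>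

lemma diag_powers_tendsto:
  assumes d0: "d 0 = 1" and d1: "\<And>n. n \<ge> 1 \<Longrightarrow> \<bar>d n\<bar> < 1"
  shows "(\<lambda>k. (app (diag_op d) ^^ k) \<zeta>) \<longlonglongrightarrow> coord \<zeta> 0 *\<^sub>C basis 0"
proof -
  have le: "\<bar>d n\<bar> \<le> 1" for n
    using d0 d1[of n] by (cases "n = 0") auto
  have coord_pow: "coord ((app (diag_op d) ^^ k) \<zeta>) n = of_real (d n) ^ k * coord \<zeta> n" for k n
    by (induction k) (simp_all add: coord_diag[OF le])
  define h where "h k n = (cmod (coord ((app (diag_op d) ^^ k) \<zeta> - coord \<zeta> 0 *\<^sub>C basis 0) n))\<^sup>2"
    for k n
  have h: "h k n = (if n = 0 then 0 else \<bar>d n\<bar> ^ (2 * k) * (cmod (coord \<zeta> n))\<^sup>2)" for k n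
    by (simp add: h_def coord_pow coord_basis d0 norm_mult norm_power power_mult_distrib
        power_mult[symmetric] mult.commute)
  have "(\<lambda>k. \<Sum>n. h k n) \<longlonglongrightarrow> (\<Sum>n. 0)"
  proof (rule tannerys_theorem[where M = "\<lambda>n. (cmod (coord \<zeta> n))\<^sup>2",
        THEN conjunct2, THEN conjunct2])
    show "((\<lambda>k. h k n) \<longlongrightarrow> 0) sequentially" for n
    proof (cases "n = 0")
      case False
      have "(\<lambda>k. (\<bar>d n\<bar>\<^sup>2) ^ k * (cmod (coord \<zeta> n))\<^sup>2) \<longlonglongrightarrow> 0 * (cmod (coord \<zeta> n))\<^sup>2"
        using d1[of n] False
        by (intro tendsto_mult tendsto_const LIMSEQ_realpow_zero) (auto simp: abs_square_less_1)
      then show ?thesis using False by (simp add: h power_mult)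
    qed (simp add: h)
    show "\<forall>\<^sub>F (n, k) in at_top \<times>\<^sub>F sequentially. norm (h k n) \<le> (cmod (coord \<zeta> n))\<^sup>2"
      by (intro always_eventually)
         (auto simp: h intro!: mult_left_le_one_le power_le_one le)
  qed (simp_all add: summable_coord)
  from tendsto_real_sqrt[OF this]
  have "(\<lambda>k. norm ((app (diag_op d) ^^ k) \<zeta> - coord \<zeta> 0 *\<^sub>C basis 0)) \<longlonglongrightarrow> 0"
    by (simp add: norm_ell2_def h_def)
  then show ?thesis by (simp add: LIM_zero_cancel tendsto_norm_zero_iff)
qed

text \<open>The operator \<open>s\<^sup>*b\<close> carries a nonzero coordinate down to index \<open>0\<close>, powers of \<open>a\<close> then isolate
  \<open>e\<^sub>0\<close>, and \<open>bs\<close> reaches every other basis vector from there. Each step moves a single vector,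
  which suits the null vectors of a quadratic form as well as the range of a projection.\<close>

lemma walk_invariant_set_contains_basis:
  assumes "\<alpha> 0 = 1" and \<alpha>: "\<And>n. n \<ge> 1 \<Longrightarrow> \<bar>\<alpha> n\<bar> < 1"
    and \<beta>: "\<And>n. \<bar>\<beta> n\<bar> \<le> 1" "\<And>n. n \<ge> 1 \<Longrightarrow> \<beta> n \<noteq> 0"
    and C: "closed C" "\<And>c \<zeta>. \<zeta> \<in> C \<Longrightarrow> c *\<^sub>C \<zeta> \<in> C"
    and inv: "\<And>\<zeta>. \<zeta> \<in> C \<Longrightarrow> app (diag_op \<alpha>) \<zeta> \<in> C"
      "\<And>\<zeta>. \<zeta> \<in> C \<Longrightarrow> app (diag_op \<beta> * shift) \<zeta> \<in> C"
      "\<And>\<zeta>. \<zeta> \<in> C \<Longrightarrow> app (adj shift * diag_op \<beta>) \<zeta> \<in> C"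
    and \<zeta>: "\<zeta> \<in> C" "\<zeta> \<noteq> 0"
  shows "basis n \<in> C"
proof -
  have "\<exists>\<eta>\<in>C. coord \<eta> 0 \<noteq> 0"
  proof -
    obtain m where "coord \<zeta> m \<noteq> 0"
      using \<zeta>(2) ell2_eqI[of \<zeta> 0] by auto
    then show ?thesis using \<zeta>(1)
    proof (induction m arbitrary: \<zeta>)
      case (Suc m)
      have "coord (app (adj shift * diag_op \<beta>) \<zeta>) m \<noteq> 0"
        using Suc.prems(1) \<beta>(2)[of "Suc m"] by (simp add: coord_adj_shift coord_diag[OF \<beta>(1)])
      then show ?case using Suc.IH inv(3)[OF Suc.prems(2)] by blast
    qed blast
  qed
  then obtain \<eta> where \<eta>: "\<eta> \<in> C" "coord \<eta> 0 \<noteq> 0" by blast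
  have "(app (diag_op \<alpha>) ^^ k) \<eta> \<in> C" for k
    by (induction k) (auto intro: \<eta>(1) inv(1))
  \<comment> \<open>The powers of \<open>a\<close> filter out the component along \<open>e\<^sub>0\<close>.\<close>
  then have "coord \<eta> 0 *\<^sub>C basis 0 \<in> C"
    using closed_sequentially[OF C(1) _ diag_powers_tendsto[of \<alpha> \<eta>]] assms(1) \<alpha> by blast
  from C(2)[OF this, of "1 / coord \<eta> 0"] have "basis 0 \<in> C"
    using \<eta>(2) by (simp add: scaleC_scaleC scaleC_one)
  then show ?thesis
  proof (induction n)
    case (Suc n)
    have "bounded (range \<beta>)" using \<beta>(1) by (auto simp: bounded_iff)
    then have "app (diag_op \<beta> * shift) (basis n) = of_real (\<beta> (Suc n)) *\<^sub>C basis (Suc n)"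
      by (simp add: app_shift_basis app_diag_basis)
    with C(2)[OF inv(2)[OF Suc.IH[OF Suc.prems]], of "1 / of_real (\<beta> (Suc n))"] \<beta>(2)[of "Suc n"]
    show ?case by (simp add: scaleC_scaleC scaleC_one)
  qed
qed

section \<open>Positive functionals\<close>

definition positive_functional :: "(bop \<Rightarrow> complex) \<Rightarrow> bool" where
  "positive_functional f \<longleftrightarrow>
     (\<forall>x y. f (x + y) = f x + f y) \<and> (\<forall>c x. f (c *\<^sub>C x) = c * f x) \<and>
     (\<forall>x. f (adj x * x) \<in> \<real>\<^sub>\<ge>\<^sub>0)"

lemma positive_functionalD:
  assumes "positive_functional f"
  shows "f (x + y) = f x + f y" "f (c *\<^sub>C x) = c * f x" "f (adj x * x) \<in> \<real>\<^sub>\<ge>\<^sub>0"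
  using assms by (auto simp: positive_functional_def)

lemma positive_functional_diff:
  assumes "positive_functional f"
  shows "f (x - y) = f x - f y"
  using positive_functionalD(1)[OF assms, of "x - y" y] by simp

lemma positive_functional_vector: "positive_functional (\<lambda>x. cinner \<xi> (app x \<xi>))"
  unfolding positive_functional_def
  by (auto simp: cinner_add_right cinner_scale_right)
     (metis adj_adj cinner_adj cinner_self_nonneg)

text \<open>The degenerate case of the Cauchy-Schwarz inequality: the value at \<open>(A + tY)\<^sup>* (A + tY)\<close> would
  become negative for a suitable \<open>t\<close> if the linear term in \<open>t\<close> did not vanish.\<close>

lemma positive_functional_null_left:
  assumes f: "positive_functional f" and A: "f (adj A * A) = 0"
  shows "f (adj A * Y) = 0"
proof -
  define z w m where "z = f (adj A * Y)" and "w = f (adj Y * A)" and "m = f (adj Y * Y)"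
  have exp: "t * z + cnj t * w + t * cnj t * m \<in> \<real>\<^sub>\<ge>\<^sub>0" for t
  proof -
    have "adj (A + t *\<^sub>C Y) * (A + t *\<^sub>C Y) = adj A * A + t *\<^sub>C (adj A * Y)
        + cnj t *\<^sub>C (adj Y * A) + (t * cnj t) *\<^sub>C (adj Y * Y)"
      by (simp add: adj_add adj_scaleC distrib_left distrib_right mult_scaleC_left
          mult_scaleC_right scaleC_scaleC scaleC_add_right add_ac mult.commute)
    then have "f (adj (A + t *\<^sub>C Y) * (A + t *\<^sub>C Y)) = t * z + cnj t * w + t * cnj t * m"
      by (simp add: positive_functionalD[OF f] A z_def w_def m_def)
    then show ?thesis using positive_functionalD(3)[OF f, of "A + t *\<^sub>C Y"] by simp
  qed
  have m: "m \<in> \<real>\<^sub>\<ge>\<^sub>0" unfolding m_def by (rule positive_functionalD[OF f])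
  \<comment> \<open>Reality of the expansion at \<open>t = 1\<close> and \<open>t = \<i>\<close> makes \<open>f\<close> hermitian on this pair.\<close>
  have "w = cnj z"
    using exp[of 1] exp[of \<i>] m
    by (auto simp: complex_nonneg_Reals_iff complex_eq_iff)
  moreover have "Re (- of_real r * cnj z * z - of_real r * z * w + of_real r * of_real r * cnj z * z * m) \<ge> 0"
    for r
    using exp[of "- of_real r * cnj z"] by (simp add: complex_nonneg_Reals_iff algebra_simps)
  ultimately have ineq: "0 \<le> (cmod z)\<^sup>2 * (r * r * Re m - 2 * r)" for r
    using m unfolding cmod_power2
    by (auto simp: complex_nonneg_Reals_iff power2_eq_square algebra_simps)
  \<comment> \<open>The choice \<open>r = 1/m\<close> minimises the quadratic polynomial, which is linear for \<open>m = 0\<close>.\<close>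
  have "\<exists>r. r * r * Re m - 2 * r < 0"
  proof (cases "Re m = 0")
    case False
    then have "Re m > 0" using m by (simp add: complex_nonneg_Reals_iff)
    then show ?thesis by (intro exI[of _ "1 / Re m"]) simp
  qed (auto intro: exI[of _ 1])
  with ineq have "(cmod z)\<^sup>2 = 0"
    by (smt (verit) mult_pos_neg zero_le_power2)
  then show ?thesis by (simp add: z_def)
qed

text \<open>The null space of a positive functional is a left ideal.\<close>

lemma positive_functional_null_mult:
  assumes f: "positive_functional f" and A: "f (adj A * A) = 0"
  shows "f (adj (B * A) * (B * A)) = 0"
  using positive_functional_null_left[OF f A, of "adj B * (B * A)"]
  by (simp add: adj_mult mult.assoc)

text \<open>Completing the square: \<open>h N = (hA + kB)\<^sup>* (hA + kB) + (hg - |k|\<^sup>2) B\<^sup>* B\<close>. The conclusion names only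
  \<open>B\<close>; the roles of \<open>A\<close> and \<open>B\<close> can be exchanged by exchanging \<open>h\<close> with \<open>g\<close> and conjugating \<open>k\<close>.\<close>

lemma positive_form_null:
  assumes f: "positive_functional f"
    and h: "0 < h" and det: "(cmod k)\<^sup>2 < h * g"
    and N: "N = of_real h *\<^sub>C (adj A * A) + k *\<^sub>C (adj A * B) + cnj k *\<^sub>C (adj B * A)
      + of_real g *\<^sub>C (adj B * B)"
  shows "f N \<in> \<real>\<^sub>\<ge>\<^sub>0" "f N = 0 \<Longrightarrow> f (adj B * B) = 0"
proof -
  let ?D = "of_real h *\<^sub>C A + k *\<^sub>C B"
  have "of_real h *\<^sub>C N = adj ?D * ?D + of_real (h * g - (cmod k)\<^sup>2) *\<^sub>C (adj B * B)"
  proof -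
    have "adj ?D * ?D = of_real h *\<^sub>C (of_real h *\<^sub>C (adj A * A) + k *\<^sub>C (adj A * B)
        + cnj k *\<^sub>C (adj B * A)) + of_real ((cmod k)\<^sup>2) *\<^sub>C (adj B * B)"
      unfolding complex_norm_square
      by (simp add: adj_add adj_scaleC distrib_left distrib_right mult_scaleC_left
          mult_scaleC_right scaleC_scaleC scaleC_add_right add_ac mult.commute)
    then show ?thesis
      by (simp add: N scaleC_add_right add.assoc scaleC_add_left[symmetric] scaleC_scaleC
          of_real_add[symmetric] of_real_mult[symmetric] del: of_real_add of_real_mult)
  qed
  then have eq: "of_real h * f N = f (adj ?D * ?D) + of_real (h * g - (cmod k)\<^sup>2) * f (adj B * B)"
    by (metis positive_functionalD(1,2)[OF f])
  note nn = positive_functionalD(3)[OF f, of ?D] positive_functionalD(3)[OF f, of B]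
  have ReN: "h * Re (f N) = Re (f (adj ?D * ?D)) + (h * g - (cmod k)\<^sup>2) * Re (f (adj B * B))"
    using arg_cong[OF eq, of Re] by simp
  have ImN: "h * Im (f N) = 0"
    using arg_cong[OF eq, of Im] nn by (simp add: complex_nonneg_Reals_iff)
  have "0 \<le> h * Re (f N)"
    unfolding ReN using nn det by (simp add: complex_nonneg_Reals_iff)
  then show "f N \<in> \<real>\<^sub>\<ge>\<^sub>0" using ImN h by (simp add: complex_nonneg_Reals_iff zero_le_mult_iff)
  show "f (adj B * B) = 0" if "f N = 0"
  proof -
    have "(h * g - (cmod k)\<^sup>2) * Re (f (adj B * B)) = 0"
    proof -
      have "0 \<le> Re (f (adj ?D * ?D))" "0 \<le> (h * g - (cmod k)\<^sup>2) * Re (f (adj B * B))"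
        using nn det by (simp_all add: complex_nonneg_Reals_iff)
      moreover have "h * Re (f N) = 0" using that by simp
      ultimately show ?thesis using ReN by linarith
    qed
    then show ?thesis using nn det by (simp add: complex_nonneg_Reals_iff complex_eq_iff)
  qed
qed

section \<open>Faithful states on matrices\<close>

text \<open>The matrix \<open>(\<psi> E\<^sub>k\<^sub>l)\<close> is positive definite, because its quadratic form at \<open>(v, w)\<close> is
  \<open>\<psi> (y\<^sup>* y)\<close> for the matrix \<open>y\<close> with first row \<open>(v, w)\<close> and second row zero.\<close>

lemma faithful_state_M2_matrix:
  assumes \<psi>: "state_M2 \<psi>" "faithful_M2 \<psi>"
  obtains h g :: real and k :: complex
  where "\<psi> (unit_mat 1 1) = of_real h" "\<psi> (unit_mat 2 2) = of_real g"
    "\<psi> (unit_mat 1 2) = k" "\<psi> (unit_mat 2 1) = cnj k" "0 < h" "0 < g" "(cmod k)\<^sup>2 < h * g"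
proof -
  define a b c d where "a = \<psi> (unit_mat 1 1)" and "b = \<psi> (unit_mat 1 2)"
    and "c = \<psi> (unit_mat 2 1)" and "d = \<psi> (unit_mat 2 2)"
  have form: "v * cnj v * a + cnj v * w * b + cnj w * v * c + w * cnj w * d \<in> \<real>\<^sub>\<ge>\<^sub>0 \<and>
      (v * cnj v * a + cnj v * w * b + cnj w * v * c + w * cnj w * d = 0 \<longrightarrow> v = 0 \<and> w = 0)"
    for v w
  proof -
    let ?y = "cmat_scale v (unit_mat 1 1) + cmat_scale w (unit_mat 1 2)"
    have "cmat_adj ?y ** ?y = cmat_scale (v * cnj v) (unit_mat 1 1)
        + cmat_scale (cnj v * w) (unit_mat 1 2) + cmat_scale (cnj w * v) (unit_mat 2 1)
        + cmat_scale (w * cnj w) (unit_mat 2 2)"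
      by (simp add: vec_eq_iff forall_2 cmat_adj_def cmat_scale_def unit_mat_def
          matrix_matrix_mult_def sum_2 mult.commute)
    then have eq: "\<psi> (cmat_adj ?y ** ?y)
        = v * cnj v * a + cnj v * w * b + cnj w * v * c + w * cnj w * d"
      using \<psi>(1) by (simp add: state_M2_def a_def b_def c_def d_def)
    have "\<psi> (cmat_adj ?y ** ?y) \<in> \<real>\<^sub>\<ge>\<^sub>0" using \<psi>(1) by (simp add: state_M2_def)
    moreover have "v = 0 \<and> w = 0" if "\<psi> (cmat_adj ?y ** ?y) = 0"
    proof -
      have "?y = 0" using \<psi>(2) that by (simp add: faithful_M2_def)
      then show ?thesis
        by (simp add: vec_eq_iff forall_2 cmat_scale_def unit_mat_def)
    qed
    ultimately show ?thesis unfolding eq by blast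
  qed
  have a: "Re a > 0" "Im a = 0" and d: "Re d > 0" "Im d = 0"
    using form[of 1 0] form[of 0 1] by (auto simp: complex_nonneg_Reals_iff complex_eq_iff)
  have c: "c = cnj b"
    using form[of 1 1] form[of 1 \<i>] a d by (auto simp: complex_nonneg_Reals_iff complex_eq_iff)
  have a': "a = of_real (Re a)" and d': "d = of_real (Re d)"
    using a d by (simp_all add: complex_eq_iff)
  \<comment> \<open>The first row of the matrix annihilates the vector \<open>(-b, a)\<close>, so the form takes there
    the value of the first entry times the determinant.\<close>
  have "(- b) * cnj (- b) * a + cnj (- b) * a * b + cnj a * (- b) * c + a * cnj a * d
      = of_real (Re a * (Re a * Re d - (cmod b)\<^sup>2))"
    unfolding c of_real_mult of_real_diff complex_norm_square using a d
    by (subst (1 2 3 4 5 6) a', subst d') (simp add: algebra_simps)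
  with form[of "- b" a] a have "0 \<le> Re a * (Re a * Re d - (cmod b)\<^sup>2)"
    "Re a * (Re a * Re d - (cmod b)\<^sup>2) \<noteq> 0"
    by (auto simp del: of_real_mult of_real_diff)
  then have "(cmod b)\<^sup>2 < Re a * Re d" using a
    by (smt (verit) mult_eq_0_iff zero_le_mult_iff)
  then show ?thesis
    using that[of "Re a" "Re d" b] a d a' d' c by (simp add: a_def b_def c_def d_def)
qed

text \<open>The slice is a sum over the rows \<open>j\<close> of \<open>A\<close> of forms with the positive definite matrix of \<open>\<psi>\<close>, and
  completing the square in either variable isolates \<open>A\<^sub>j\<^sub>2\<close> or \<open>A\<^sub>j\<^sub>1\<close>. Testing by one functional \<open>f\<close> at
  a time serves both purposes: vector functionals give irreducibility, invariant states give
  faithfulness and weak mixing.\<close>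

lemma slice_null:
  assumes \<psi>: "state_M2 \<psi>" "faithful_M2 \<psi>" and f: "positive_functional f"
  shows "f (slice \<psi> (bmat_adj A ** A)) \<in> \<real>\<^sub>\<ge>\<^sub>0"
    and "f (slice \<psi> (bmat_adj A ** A)) = 0 \<Longrightarrow> f (adj (A $ j $ k) * A $ j $ k) = 0"
proof -
  obtain h g :: real and c :: complex
    where H: "\<psi> (unit_mat 1 1) = of_real h" "\<psi> (unit_mat 2 2) = of_real g"
      "\<psi> (unit_mat 1 2) = c" "\<psi> (unit_mat 2 1) = cnj c" "0 < h" "0 < g" "(cmod c)\<^sup>2 < h * g"
    using faithful_state_M2_matrix[OF \<psi>] by blast
  define N where "N j = of_real h *\<^sub>C (adj (A$j$1) * A$j$1) + c *\<^sub>C (adj (A$j$1) * A$j$2)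
    + cnj c *\<^sub>C (adj (A$j$2) * A$j$1) + of_real g *\<^sub>C (adj (A$j$2) * A$j$2)" for j :: 2
  have eq: "slice \<psi> (bmat_adj A ** A) = N 1 + N 2"
    by (simp add: slice_def N_def bmat_adj_def matrix_matrix_mult_def sum_2 H scaleC_add_right
        add_ac)
  have N': "N j = of_real g *\<^sub>C (adj (A$j$2) * A$j$2) + cnj c *\<^sub>C (adj (A$j$2) * A$j$1)
    + cnj (cnj c) *\<^sub>C (adj (A$j$1) * A$j$2) + of_real h *\<^sub>C (adj (A$j$1) * A$j$1)" for j
    by (simp add: N_def add_ac)
  have det': "(cmod (cnj c))\<^sup>2 < g * h" using H(7) by (simp add: mult.commute)
  have nn: "f (N j) \<in> \<real>\<^sub>\<ge>\<^sub>0" for j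
    by (rule positive_form_null(1)[OF f H(5) H(7) N_def])
  have sum: "f (N 1 + N 2) = f (N 1) + f (N 2)" by (rule positive_functionalD(1)[OF f])
  show "f (slice \<psi> (bmat_adj A ** A)) \<in> \<real>\<^sub>\<ge>\<^sub>0"
    unfolding eq sum by (intro nonneg_Reals_add_I nn)
  assume "f (slice \<psi> (bmat_adj A ** A)) = 0"
  then have "f (N 1) + f (N 2) = 0" by (simp only: eq sum)
  then have "f (N 1) = 0" "f (N 2) = 0"
    using nn[of 1] nn[of 2] by (auto simp: complex_nonneg_Reals_iff complex_eq_iff)
  then have "f (N j) = 0" by (metis (full_types) exhaust_2)
  then have "f (adj (A$j$2) * A$j$2) = 0" "f (adj (A$j$1) * A$j$1) = 0"
    using positive_form_null(2)[OF f H(5) H(7) N_def]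
      positive_form_null(2)[OF f H(6) det' N'] by blast+
  then show "f (adj (A $ j $ k) * A $ j $ k) = 0" by (metis (full_types) exhaust_2)
qed

section \<open>The transition operator\<close>

lemma bmat_adj_mult: "bmat_adj (A ** B) = bmat_adj B ** bmat_adj A"
  by (simp add: vec_eq_iff forall_2 bmat_adj_def matrix_matrix_mult_def sum_2 adj_add adj_mult)

lemma bmat_adj_minus: "bmat_adj (A - B) = bmat_adj A - bmat_adj B"
  by (simp add: vec_eq_iff bmat_adj_def adj_minus)

lemma slice_minus: "slice \<psi> (A - B) = slice \<psi> A - slice \<psi> B"
  using slice_linear(1)[of \<psi> "A - B" B] by simp

text \<open>The operator \<open>x \<otimes> 1\<close>.\<close>

abbreviation ampl :: "bop \<Rightarrow> bop^2^2" where
  "ampl x \<equiv> tensor x (mat 1)"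

lemma ampl_nth: "ampl x $ i $ j = (if i = j then x else 0)"
  by (simp add: tensor_def mat_def scaleC_one)

lemma ampl_one: "ampl 1 = mat 1"
  by (simp add: vec_eq_iff ampl_nth) (simp add: mat_def)

lemma ampl_mult: "ampl (x * y) = ampl x ** ampl y"
  by (auto simp: vec_eq_iff forall_2 ampl_nth matrix_matrix_mult_def sum_2)

lemma bmat_adj_ampl: "bmat_adj (ampl x) = ampl (adj x)"
proof -
  have "adj 0 = 0" by (rule adj_unique) (simp add: cinner_def)
  then show ?thesis by (simp add: vec_eq_iff ampl_nth bmat_adj_def)
qed

lemma ampl_mult_nth: "(ampl x ** A) $ i $ j = x * A $ i $ j"
  using exhaust_2[of i] by (auto simp: ampl_nth matrix_matrix_mult_def sum_2)

lemma mult_ampl_nth: "(A ** ampl x) $ i $ j = A $ i $ j * x"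
  using exhaust_2[of j] by (auto simp: ampl_nth matrix_matrix_mult_def sum_2)

lemma slice_ampl_left: "slice \<psi> (ampl x ** A) = x * slice \<psi> A"
  by (simp add: slice_def ampl_mult_nth sum_2 distrib_left mult_scaleC_right)

lemma slice_ampl_right: "slice \<psi> (A ** ampl x) = slice \<psi> A * x"
  by (simp add: slice_def mult_ampl_nth sum_2 distrib_right mult_scaleC_left)

lemma slice_one: "state_M2 \<psi> \<Longrightarrow> slice \<psi> (mat 1) = 1"
  unfolding ampl_one[symmetric] by (simp add: slice_tensor state_M2_def scaleC_one)

lemma slice_adj:
  assumes "state_M2 \<psi>" "faithful_M2 \<psi>"
  shows "slice \<psi> (bmat_adj A) = adj (slice \<psi> A)"
  by (rule faithful_state_M2_matrix[OF assms])
    (simp add: slice_def bmat_adj_def sum_2 adj_add adj_scaleC add_ac)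

lemma bmat_adj_adj: "bmat_adj (bmat_adj A) = A"
  by (simp add: vec_eq_iff bmat_adj_def adj_adj)

text \<open>The defect in the Kadison-Schwarz inequality is itself the slice of a square, so \<open>slice_null\<close>
  turns equality in that inequality into the intertwining relation \<open>A = 0\<close>.\<close>

lemma slice_defect:
  fixes x :: bop
  assumes \<psi>: "state_M2 \<psi>" "faithful_M2 \<psi>" and u: "bmat_adj u ** u = mat 1"
  defines "T \<equiv> \<lambda>x. slice \<psi> (bmat_adj u ** ampl x ** u)"
  defines "A \<equiv> ampl x ** u - u ** ampl (T x)"
  shows "slice \<psi> (bmat_adj A ** A) = T (adj x * x) - adj (T x) * T x"
proof -
  let ?v = "bmat_adj u" and ?y = "T x"
  have T_adj: "T (adj x) = adj (T x)"
    by (simp add: T_def slice_adj[OF \<psi>, symmetric] bmat_adj_mult bmat_adj_ampl matrix_mul_assoc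
        bmat_adj_adj)
  have diff: "(B - C) ** (D - E) = B ** D - B ** E - C ** D + C ** E" for B C D E :: "bop^2^2"
    by (simp add: vec_eq_iff matrix_matrix_mult_def sum_2 algebra_simps)
  have "bmat_adj A ** A = ?v ** ampl (adj x * x) ** u - ?v ** ampl (adj x) ** u ** ampl ?y
      - ampl (adj ?y) ** (?v ** ampl x ** u) + ampl (adj ?y) ** (?v ** u) ** ampl ?y"
    by (simp add: A_def bmat_adj_minus bmat_adj_mult bmat_adj_ampl ampl_mult diff matrix_mul_assoc)
  then have "slice \<psi> (bmat_adj A ** A) = T (adj x * x) - T (adj x) * ?y - adj ?y * ?y + adj ?y * ?y"
    by (simp add: slice_linear(1) slice_minus slice_ampl_left slice_ampl_right u T_def
        flip: ampl_mult) (simp add: slice_tensor[OF \<psi>(1)] \<psi>(1)[unfolded state_M2_def] scaleC_one)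
  then show ?thesis by (simp add: T_adj)
qed

lemma walk_unitary_nth:
  "walk_unitary \<alpha> \<beta> $ 1 $ 2 = \<i> *\<^sub>C (adj shift * diag_op \<beta>)"
  "walk_unitary \<alpha> \<beta> $ 2 $ 1 = \<i> *\<^sub>C (diag_op \<beta> * shift)"
  "walk_unitary \<alpha> \<beta> $ 2 $ 2 = diag_op \<alpha>"
  by (simp_all add: walk_unitary_def Let_def)

locale walk =
  fixes \<alpha> \<beta> :: "nat \<Rightarrow> real" and \<psi> :: "complex^2^2 \<Rightarrow> complex"
  assumes sq: "\<And>n. (\<alpha> n)\<^sup>2 + (\<beta> n)\<^sup>2 = 1"
    and \<alpha>0: "\<alpha> 0 = 1"
    and \<beta>_nonzero: "\<And>n. n \<ge> 1 \<Longrightarrow> \<beta> n \<noteq> 0"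
    and \<psi>: "state_M2 \<psi>" "faithful_M2 \<psi>"
begin

abbreviation "u \<equiv> walk_unitary \<alpha> \<beta>"
abbreviation "T \<equiv> transition \<alpha> \<beta> \<psi>"

lemma \<alpha>_le: "\<bar>\<alpha> n\<bar> \<le> 1" and \<beta>_le: "\<bar>\<beta> n\<bar> \<le> 1"
proof -
  have "(\<alpha> n)\<^sup>2 \<le> 1" "(\<beta> n)\<^sup>2 \<le> 1"
    using sq[of n] zero_le_power2[of "\<alpha> n"] zero_le_power2[of "\<beta> n"] by linarith+
  then show "\<bar>\<alpha> n\<bar> \<le> 1" "\<bar>\<beta> n\<bar> \<le> 1" by (simp_all add: abs_square_le_1)
qed

lemma \<alpha>_less: "\<bar>\<alpha> n\<bar> < 1" if "n \<ge> 1"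
proof -
  have "0 < (\<beta> n)\<^sup>2" using \<beta>_nonzero[OF that] by simp
  then have "(\<alpha> n)\<^sup>2 < 1" using sq[of n] by linarith
  then show ?thesis by (simp add: abs_square_less_1)
qed

lemma u_isometry: "bmat_adj u ** u = mat 1"
  by (rule walk_unitary_unitary(1)) (rule sq \<alpha>0)+

lemma T_slice: "T x = slice \<psi> (bmat_adj u ** ampl x ** u)"
  by (simp add: transition_def Let_def)

lemma T_square: "T (adj R * R) = slice \<psi> (bmat_adj (ampl R ** u) ** (ampl R ** u))"
  by (simp add: T_slice bmat_adj_mult bmat_adj_ampl ampl_mult matrix_mul_assoc)

lemma T_one: "T 1 = 1"
  by (simp add: T_slice ampl_one u_isometry slice_one[OF \<psi>(1)])

lemma T_minus: "T (x - y) = T x - T y"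
proof -
  have "bmat_adj u ** ampl (x - y) ** u = bmat_adj u ** ampl x ** u - bmat_adj u ** ampl y ** u"
    by (simp add: vec_eq_iff forall_2 matrix_matrix_mult_def sum_2 ampl_nth algebra_simps)
  then show ?thesis by (simp add: T_slice slice_minus)
qed

section \<open>Irreducibility\<close>

text \<open>Up to scalars, taking adjoints fixes \<open>a\<close> and exchanges \<open>bs\<close> with \<open>s\<^sup>*b\<close>, so invariance under the
  entries of \<open>u\<close> and under their adjoints are equally good.\<close>

lemma basis_in_invariant_set:
  assumes C: "closed C" "\<And>c \<zeta>. \<zeta> \<in> C \<Longrightarrow> c *\<^sub>C \<zeta> \<in> C" and \<zeta>: "\<zeta> \<in> C" "\<zeta> \<noteq> 0"
    and inv: "(\<forall>j k. \<forall>\<zeta>\<in>C. app (u $ j $ k) \<zeta> \<in> C) \<or> (\<forall>j k. \<forall>\<zeta>\<in>C. app (adj (u $ j $ k)) \<zeta> \<in> C)"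
  shows "basis n \<in> C"
proof -
  have scale: "c *\<^sub>C \<zeta> \<in> C \<longleftrightarrow> \<zeta> \<in> C" if "c \<noteq> 0" for c \<zeta>
    using C(2)[of \<zeta> c] C(2)[of "c *\<^sub>C \<zeta>" "1 / c"] that by (auto simp: scaleC_scaleC scaleC_one)
  have "app (diag_op \<alpha>) \<zeta> \<in> C \<and> app (diag_op \<beta> * shift) \<zeta> \<in> C \<and> app (adj shift * diag_op \<beta>) \<zeta> \<in> C"
    if "\<zeta> \<in> C" for \<zeta>
    using inv
  proof
    assume *: "\<forall>j k. \<forall>\<zeta>\<in>C. app (u $ j $ k) \<zeta> \<in> C"
    show ?thesis
      using *[rule_format, of \<zeta> 2 2] *[rule_format, of \<zeta> 2 1] *[rule_format, of \<zeta> 1 2] that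
      by (simp add: walk_unitary_nth scale)
  next
    assume *: "\<forall>j k. \<forall>\<zeta>\<in>C. app (adj (u $ j $ k)) \<zeta> \<in> C"
    show ?thesis
      using *[rule_format, of \<zeta> 2 2] *[rule_format, of \<zeta> 2 1] *[rule_format, of \<zeta> 1 2] that
      by (simp add: walk_unitary_nth scale adj_mult adj_scaleC adj_adj adj_diag[OF \<alpha>_le]
          adj_diag[OF \<beta>_le])
  qed
  then show ?thesis
    using \<alpha>0 \<alpha>_less \<beta>_le \<beta>_nonzero C \<zeta>
    by (intro walk_invariant_set_contains_basis[of \<alpha> \<beta> C \<zeta>]) blast+
qed

text \<open>The range of a subharmonic projection is invariant under the entries of \<open>u\<close>, since \<open>T (1 - p)\<close>
  has expectation zero in each of its vectors.\<close>

lemma irreducible_transition: "irreducible_map T"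
  unfolding irreducible_map_def
proof (intro allI impI)
  fix p
  assume "subharmonic T p"
  then have p: "adj p = p" "p * p = p" and pos: "positive_op (T p - p)"
    by (auto simp: subharmonic_def projection_def)
  let ?C = "{\<xi>. app p \<xi> = \<xi>}"
  let ?q = "1 - p"
  have q: "adj ?q * ?q = ?q" by (simp add: adj_minus p algebra_simps)
  have inv: "app (u $ j $ k) \<xi> \<in> ?C" if "\<xi> \<in> ?C" for j k \<xi>
  proof -
    let ?f = "\<lambda>x. cinner \<xi> (app x \<xi>)"
    note f = positive_functional_vector[of \<xi>]
    have "?f (T ?q) = - ?f (T p - p)"
      using that by (simp add: T_minus T_one positive_functional_diff[OF f] del: app_simps)
        (simp add: positive_functional_diff[OF f])
    moreover have "?f (T p - p) \<in> \<real>\<^sub>\<ge>\<^sub>0" using pos by (simp only: positive_op_def)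
    moreover have "?f (T ?q) \<in> \<real>\<^sub>\<ge>\<^sub>0"
      using slice_null(1)[OF \<psi> f, of "ampl ?q ** u"] T_square[of ?q] by (simp only: q)
    ultimately have "?f (T ?q) = 0"
      by (simp add: complex_nonneg_Reals_iff complex_eq_iff del: app_simps)
    then have "?f (adj (?q * u $ j $ k) * (?q * u $ j $ k)) = 0"
      using slice_null(2)[OF \<psi> f, of "ampl ?q ** u" j k] T_square[of ?q]
      by (simp only: q ampl_mult_nth)
    then have "cinner (app (?q * u $ j $ k) \<xi>) (app (?q * u $ j $ k) \<xi>) = 0"
      by (metis adj_adj app_simps(6) cinner_adj)
    from cinner_self_eq_0[OF this] show ?thesis by simp
  qed
  show "p = 0 \<or> p = 1"
  proof (cases "p = 0")
    case False
    then obtain \<eta> where \<eta>: "app p \<eta> \<noteq> 0" using bop_eqI[of p 0] by auto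
    have "closed ?C"
      by (intro closed_Collect_eq continuous_on_id linear_continuous_on bounded_linear_app)
    then have "basis n \<in> ?C" for n
      using \<eta> inv arg_cong[OF p(2), of "\<lambda>p. app p \<eta>"]
      by (intro basis_in_invariant_set[of ?C "app p \<eta>"]) (auto simp: app_scaleC)
    then have "p = 1" by (intro bop_eq_on_basis) auto
    then show ?thesis ..
  qed simp
qed

section \<open>Faithfulness of normal invariant states\<close>

text \<open>Instead of the support projection of the state, the set \<open>K\<close> of null vectors of the form
  \<open>\<langle>\<zeta>, \<rho> \<zeta>\<rangle>\<close> is used: rank-one operators reduce null operators to null vectors, invariance of
  the state makes \<open>K\<close> invariant under the adjoint entries of \<open>u\<close>, and \<open>K\<close> then contains the whole basis.\<close>

lemma normal_invariant_state_faithful: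
  assumes normal: "normal_state \<phi>" and invariant: "invariant_state T \<phi>"
    and A: "\<phi> (adj A * A) = 0"
  shows "A = 0"
proof (rule ccontr)
  assume "A \<noteq> 0"
  obtain \<rho> where \<rho>: "\<And>x. \<phi> x = op_trace (\<rho> * x)"
    using normal by (auto simp: normal_state_def)
  have f: "positive_functional \<phi>" and \<phi>1: "\<phi> 1 = 1"
    using normal by (auto simp: normal_state_def state_B_def positive_functional_def)
  let ?K = "{\<zeta>. cinner \<zeta> (app \<rho> \<zeta>) = 0}"
  have \<phi>_bra: "\<phi> (adj (bra \<zeta>) * bra \<zeta>) = cinner \<zeta> (app \<rho> \<zeta>)" for \<zeta>
    by (simp add: \<rho> op_trace_def app_adj_bra_bra app_scaleC cinner_scale_right cinner_basis_left
        cinner_basis_right) (simp add: cinner_def mult.commute)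
  have "adj A \<noteq> 0"
  proof
    assume "adj A = 0"
    then have "app A y = 0" for y
      using cinner_adj[of A "app A y" y] by (intro cinner_self_eq_0) (simp add: cinner_def)
    then show False using \<open>A \<noteq> 0\<close> bop_eqI[of A 0] by auto
  qed
  then obtain \<eta> where \<eta>: "app (adj A) \<eta> \<noteq> 0" using bop_eqI[of "adj A" 0] by auto
  have "app (adj A) \<eta> \<in> ?K"
    using positive_functional_null_mult[OF f A, of "bra \<eta>"] by (simp add: bra_mult \<phi>_bra)
  moreover have "app (adj (u $ j $ k)) \<zeta> \<in> ?K" if "\<zeta> \<in> ?K" for j k \<zeta>
  proof -
    have "\<phi> (T (adj (bra \<zeta>) * bra \<zeta>)) = 0"
      using invariant that by (simp add: invariant_state_def \<phi>_bra fun_eq_iff)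
    then have "\<phi> (slice \<psi> (bmat_adj (ampl (bra \<zeta>) ** u) ** (ampl (bra \<zeta>) ** u))) = 0"
      by (simp only: T_square)
    from slice_null(2)[OF \<psi> f this, of j k] show ?thesis
      by (simp add: ampl_mult_nth bra_mult \<phi>_bra)
  qed
  moreover have "closed ?K"
    by (intro closed_Collect_eq continuous_intros linear_continuous_on bounded_linear_app)
  ultimately have "basis n \<in> ?K" for n
    using \<eta> by (intro basis_in_invariant_set[of ?K "app (adj A) \<eta>"])
      (auto simp: app_scaleC cinner_scale_left cinner_scale_right)
  then have "\<phi> 1 = 0" by (simp add: \<rho> op_trace_def)
  then show False using \<phi>1 by simp
qed

section \<open>Weak mixing\<close>

text \<open>For \<open>|\<mu>| = 1\<close> the invariant state vanishes on the Kadison-Schwarz defect of \<open>x\<close>; being faithful,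
  it forces \<open>x\<close> to commute with every entry of \<open>u\<close> up to the factor \<open>\<mu>\<close>.\<close>

lemma peripheral_eigenvector_intertwines:
  assumes \<phi>: "normal_state \<phi>" "invariant_state T \<phi>"
    and x: "T x = \<mu> *\<^sub>C x" and \<mu>: "cmod \<mu> = 1"
  shows "x * u $ j $ k = \<mu> *\<^sub>C (u $ j $ k * x)"
proof -
  have f: "positive_functional \<phi>"
    using \<phi>(1) by (auto simp: normal_state_def state_B_def positive_functional_def)
  let ?A = "ampl x ** u - u ** ampl (T x)"
  have "adj (T x) * T x = adj x * x"
    using complex_norm_square[of \<mu>] \<mu>
    by (simp add: x adj_scaleC mult_scaleC_left mult_scaleC_right scaleC_scaleC mult.commute
        scaleC_one)
  then have "slice \<psi> (bmat_adj ?A ** ?A) = T (adj x * x) - adj x * x"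
    using slice_defect[OF \<psi> u_isometry, of x] by (simp only: T_slice)
  moreover have "\<phi> (T (adj x * x)) = \<phi> (adj x * x)"
    using \<phi>(2) by (simp add: invariant_state_def fun_eq_iff)
  ultimately have "\<phi> (slice \<psi> (bmat_adj ?A ** ?A)) = 0"
    by (simp add: positive_functional_diff[OF f])
  from slice_null(2)[OF \<psi> f this, of j k] have "?A $ j $ k = 0"
    by (rule normal_invariant_state_faithful[OF \<phi>])
  then show ?thesis by (simp add: ampl_mult_nth mult_ampl_nth x mult_scaleC_right)
qed

text \<open>The intertwining relations determine \<open>x\<close> from \<open>c = \<langle>e\<^sub>0, x e\<^sub>0\<rangle>\<close>. The entry \<open>a\<close>, which fixes \<open>e\<^sub>0\<close>,
  gives \<open>\<mu> c = c\<close>; for \<open>\<mu> \<noteq> 1\<close> this says \<open>c = 0\<close> and hence \<open>x = 0\<close>, so \<open>\<mu> = 1\<close> and \<open>\<mu> \<noteq> 1\<close> can be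
  treated together.\<close>

lemma weakly_mixing_transition:
  assumes \<phi>: "normal_state \<phi>" "invariant_state T \<phi>"
  shows "weakly_mixing T"
  unfolding weakly_mixing_def
proof (intro allI impI, elim conjE)
  fix \<mu> x
  assume \<mu>: "cmod \<mu> = 1" and x: "T x = \<mu> *\<^sub>C x"
  note intertwine = peripheral_eigenvector_intertwines[OF \<phi> x \<mu>]
  have bd: "bounded (range \<alpha>)" "bounded (range \<beta>)"
    using \<alpha>_le \<beta>_le by (auto simp: bounded_iff)
  define c where "c = coord (app x (basis 0)) 0"
  \<comment> \<open>The kernel of \<open>s\<^sup>*b\<close> is spanned by \<open>e\<^sub>0\<close>.\<close>
  have lower: "app (u $ 1 $ 2) \<xi> = 0 \<longleftrightarrow> (\<forall>n. coord \<xi> (Suc n) = 0)" for \<xi>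
  proof -
    have "coord (app (u $ 1 $ 2) \<xi>) n = \<i> * of_real (\<beta> (Suc n)) * coord \<xi> (Suc n)" for n
      by (simp add: walk_unitary_nth coord_adj_shift coord_diag[OF \<beta>_le])
    then show ?thesis
      using \<beta>_nonzero ell2_eqI[of "app (u $ 1 $ 2) \<xi>" 0] by (metis (no_types, lifting)
          coord_simps(1) le_add1 mult_eq_0_iff of_real_eq_0_iff complex_i_not_zero plus_1_eq_Suc)
  qed
  have "app (u $ 1 $ 2) (basis 0) = 0" by (simp add: lower coord_basis)
  then have "\<mu> *\<^sub>C app (u $ 1 $ 2) (app x (basis 0)) = 0"
    using arg_cong[OF intertwine[of 1 2], of "\<lambda>A. app A (basis 0)"]
    by (simp add: linear_0[OF bounded_linear.linear[OF bounded_linear_app]])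
  then have "norm (app (u $ 1 $ 2) (app x (basis 0))) = 0"
    using norm_scaleC[of \<mu> "app (u $ 1 $ 2) (app x (basis 0))"] \<mu> by simp
  then have x_ker: "app (u $ 1 $ 2) (app x (basis 0)) = 0" by simp
  have x0: "app x (basis 0) = c *\<^sub>C basis 0"
  proof (rule ell2_eqI)
    fix n
    show "coord (app x (basis 0)) n = coord (c *\<^sub>C basis 0) n"
      using x_ker by (cases n) (simp_all add: lower coord_basis c_def)
  qed
  have "c *\<^sub>C basis 0 = (\<mu> * c) *\<^sub>C basis 0"
    using arg_cong[OF intertwine[of 2 2], of "\<lambda>A. app A (basis 0)"]
    by (simp add: walk_unitary_nth app_diag_basis[OF bd(1)] \<alpha>0 scaleC_one x0 app_scaleC
        scaleC_scaleC)
  from arg_cong[OF this, of "\<lambda>\<xi>. coord \<xi> 0"] have \<mu>c: "\<mu> * c = c"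
    by (simp add: coord_basis)
  have xn: "app x (basis n) = c *\<^sub>C basis n" for n
  proof (induction n)
    case (Suc n)
    let ?b = "\<i> * of_real (\<beta> (Suc n))"
    have up: "app (u $ 2 $ 1) (basis n) = ?b *\<^sub>C basis (Suc n)"
      by (simp add: walk_unitary_nth app_shift_basis app_diag_basis[OF bd(2)] scaleC_scaleC)
    have "?b *\<^sub>C app x (basis (Suc n)) = (\<mu> * c * ?b) *\<^sub>C basis (Suc n)"
      using arg_cong[OF intertwine[of 2 1], of "\<lambda>A. app A (basis n)"]
      by (simp add: Suc.IH up app_scaleC scaleC_scaleC mult.assoc)
    then have "(1 / ?b * ?b) *\<^sub>C app x (basis (Suc n)) = (1 / ?b * (\<mu> * c * ?b)) *\<^sub>C basis (Suc n)"
      by (metis scaleC_scaleC)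
    then show ?case using \<beta>_nonzero[of "Suc n"] by (simp add: \<mu>c scaleC_one)
  qed (rule x0)
  have "x = c *\<^sub>C 1" by (rule bop_eq_on_basis) (simp add: xn)
  then show "\<exists>c. x = c *\<^sub>C 1" ..
qed

end

theorem theorem4p3:
  fixes \<alpha> \<beta> :: "nat \<Rightarrow> real" and \<psi> :: "complex^2^2 \<Rightarrow> complex"
  assumes "\<And>n. \<alpha> n \<in> {-1..1}" and "\<And>n. \<beta> n \<in> {-1..1}"
    and "\<And>n. (\<alpha> n)\<^sup>2 + (\<beta> n)\<^sup>2 = 1"
    and "\<alpha> 0 = 1"
    and "\<And>n. n \<ge> 1 \<Longrightarrow> \<beta> n \<noteq> 0"
    and "state_M2 \<psi>" and "faithful_M2 \<psi>"
  shows "irreducible_map (transition \<alpha> \<beta> \<psi>) \<and>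
    ((\<exists>\<phi>. normal_state \<phi> \<and> invariant_state (transition \<alpha> \<beta> \<psi>) \<phi>) \<longrightarrow>
      weakly_mixing (transition \<alpha> \<beta> \<psi>))"
proof -
  interpret walk \<alpha> \<beta> \<psi> by standard (use assms in auto)
  show ?thesis using irreducible_transition weakly_mixing_transition by blast
qed

end
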